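(* Let $0<H<1$, let $G\in L^2(\mathbb{R},\gamma)$ have Hermite rank $m\ge 1$, and let $X^\varepsilon$ be the slow component of the slow/fast system described in the context. Let $T>0$ be any time horizon and $T=N\delta$. If $\delta=\delta(\varepsilon)>0$ is such that $\delta(\varepsilon)\to 0$ and $\delta(\varepsilon)/\varepsilon\to 0$ as $\varepsilon\to 0^+$, then $$\mathbb{E}\left[C_{\varepsilon,\delta}\right]\xrightarrow[\varepsilon\to 0^+]{}0 .$$
   Context: $\gamma=\mathcal N(0,1)$. Hermite polynomials: $H_n(x)=(-1)^n e^{x^2/2}\frac{d^n}{dx^n}e^{-x^2/2}$. A function $G\in L^2(\mathbb{R},\gamma)$ has Hermite rank $m\ge1$ if $G=\sum_{q\ge m}c_qH_q$ in $L^2(\gamma)$ with $c_m\ne0$. For $\varepsilon>0$, $Y^\varepsilon$ is the unique stationary solution of $dY^\varepsilon_t=-\frac1\varepsilon Y^\varepsilon_t\,dt+\frac{\sigma}{\varepsilon^H}\,dB^H_t$, where $B^H$ is a (two-sided) fractional Brownian motion with Hurst parameter $H$ and $\sigma^2=2/\Gamma(2H+1)$, so that $Y^\varepsilon_t\sim\mathcal N(0,1)$. Set $H^*(m)=(H-1)m+1$. The slow process is given by $dX^\varepsilon_t=\alpha(\varepsilon,H^*(m))\,G(Y^\varepsilon_t)\,dt$, with $\alpha(\varepsilon,H^*(m))=\varepsilon^{H^*(m)-1}$ if $H^*(m)>1/2$, $\;\frac1{\sqrt{\varepsilon|\log\varepsilon|}}$ if $H^*(m)=1/2$, $\;\frac1{\sqrt\varepsilon}$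 if $H^*(m)<1/2$. With $N\delta=T$, $N\in\mathbb N$, the estimator is $C_{\varepsilon,\delta}=N^{2H^*(m)-1}\sum_{i=0}^{N-1}(X^\varepsilon_{(i+1)\delta}-X^\varepsilon_{i\delta})^2$ if $H^*(m)>1/2$, and $C_{\varepsilon,\delta}=\sum_{i=0}^{N-1}(X^\varepsilon_{(i+1)\delta}-X^\varepsilon_{i\delta})^2$ if $H^*(m)\le1/2$. *)

theory Defs
  imports "HOL-Probability.Probability"
begin

text \<open>Gaussian laws may be degenerate: variance zero gives a Dirac measure.\<close>

definition gaussian_rv :: "'a measure \<Rightarrow> ('a \<Rightarrow> real) \<Rightarrow> bool" where
  "gaussian_rv M Z \<longleftrightarrow> Z \<in> borel_measurable M \<and>
     (\<exists>\<mu> s. s \<ge> 0 \<and>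
        distr M borel Z =
          (if s = 0 then return borel \<mu> else density lborel (\<lambda>x. ennreal (normal_density \<mu> s x))))"

definition gaussian_process :: "'a measure \<Rightarrow> (real \<Rightarrow> 'a \<Rightarrow> real) \<Rightarrow> bool" where
  "gaussian_process M Z \<longleftrightarrow>
     (\<forall>(J :: real set) (a :: real \<Rightarrow> real). finite J \<longrightarrow> gaussian_rv M (\<lambda>\<omega>. \<Sum>t\<in>J. a t * Z t \<omega>))"

text \<open>Two-sided, normalised so that the variance at time \<open>1\<close> is \<open>1\<close>; the covariance formula forces
  \<open>B 0 = 0\<close> almost surely.\<close>

definition fractional_brownian_motion ::
  "'a measure \<Rightarrow> real \<Rightarrow> (real \<Rightarrow> 'a \<Rightarrow> real) \<Rightarrow> bool" where
  "fractional_brownian_motion M H B \<longleftrightarrow>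
     gaussian_process M B \<and>
     (\<forall>t. (LINT \<omega>|M. B t \<omega>) = 0) \<and>
     (\<forall>s t. (LINT \<omega>|M. B s \<omega> * B t \<omega>) =
        (\<bar>s\<bar> powr (2 * H) + \<bar>t\<bar> powr (2 * H) - \<bar>t - s\<bar> powr (2 * H)) / 2) \<and>
     (AE \<omega> in M. continuous_on UNIV (\<lambda>t. B t \<omega>))"

definition strictly_stationary :: "'a measure \<Rightarrow> (real \<Rightarrow> 'a \<Rightarrow> real) \<Rightarrow> bool" where
  "strictly_stationary M Y \<longleftrightarrow>
     (\<forall>t. Y t \<in> borel_measurable M) \<and>
     (\<forall>(J :: real set) h. finite J \<longrightarrow>
        distr M (\<Pi>\<^sub>M t\<in>J. (borel :: real measure)) (\<lambda>\<omega>. \<lambda>t\<in>J. Y (t + h) \<omega>) =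
        distr M (\<Pi>\<^sub>M t\<in>J. (borel :: real measure)) (\<lambda>\<omega>. \<lambda>t\<in>J. Y t \<omega>))"

definition fou_sigma :: "real \<Rightarrow> real" where
  "fou_sigma H = sqrt (2 / Gamma (2 * H + 1))"

text \<open>The noise is additive, so the equation
  \<open>dY = - (1 / \<epsilon>) Y dt + (\<sigma> / \<epsilon>\<^sup>H) dB\<close> on the whole real line is read pathwise in integrated form.
  These conditions determine \<open>Y\<close> up to indistinguishability, and that its one-dimensional marginals
  are standard normal is a consequence of them.\<close>

definition stationary_fou_solution ::
  "'a measure \<Rightarrow> real \<Rightarrow> (real \<Rightarrow> 'a \<Rightarrow> real) \<Rightarrow> real \<Rightarrow> (real \<Rightarrow> 'a \<Rightarrow> real) \<Rightarrow> bool" where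
  "stationary_fou_solution M H B \<epsilon> Y \<longleftrightarrow>
     strictly_stationary M Y \<and>
     (AE \<omega> in M. continuous_on UNIV (\<lambda>t. Y t \<omega>) \<and>
        (\<forall>s t. s \<le> t \<longrightarrow>
           Y t \<omega> - Y s \<omega> =
             - (1 / \<epsilon>) * (LBINT r:{s..t}. Y r \<omega>)
             + fou_sigma H / \<epsilon> powr H * (B t \<omega> - B s \<omega>)))"

definition hermite_poly :: "nat \<Rightarrow> real \<Rightarrow> real" where
  "hermite_poly n x =
     (-1) ^ n * exp (x\<^sup>2 / 2) * (deriv ^^ n) (\<lambda>y. exp (- (y\<^sup>2 / 2))) x"

definition in_L2_gauss :: "(real \<Rightarrow> real) \<Rightarrow> bool" where
  "in_L2_gauss G \<longleftrightarrow>
     G \<in> borel_measurable borel \<and> integrable std_normal_distribution (\<lambda>x. (G x)\<^sup>2)"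

definition has_hermite_rank :: "(real \<Rightarrow> real) \<Rightarrow> nat \<Rightarrow> bool" where
  "has_hermite_rank G m \<longleftrightarrow>
     m \<ge> 1 \<and>
     (\<exists>c :: nat \<Rightarrow> real. c m \<noteq> 0 \<and>
        (\<lambda>n. \<integral>\<^sup>+ x. ennreal ((G x - (\<Sum>q=m..n. c q * hermite_poly q x))\<^sup>2)
               \<partial>std_normal_distribution) \<longlonglongrightarrow> 0)"

definition Hstar :: "real \<Rightarrow> nat \<Rightarrow> real" where
  "Hstar H m = (H - 1) * real m + 1"

definition slow_scaling :: "real \<Rightarrow> real \<Rightarrow> real" where
  "slow_scaling \<epsilon> h =
     (if h > 1 / 2 then \<epsilon> powr (h - 1)
      else if h = 1 / 2 then 1 / sqrt (\<epsilon> * \<bar>ln \<epsilon>\<bar>)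
      else 1 / sqrt \<epsilon>)"

text \<open>The equation \<open>dX = \<alpha> G(Y) dt\<close> on \<open>[0, \<infinity>)\<close> with an arbitrary random initial value.\<close>

definition slow_solution ::
  "'a measure \<Rightarrow> real \<Rightarrow> (real \<Rightarrow> real) \<Rightarrow> (real \<Rightarrow> 'a \<Rightarrow> real) \<Rightarrow> (real \<Rightarrow> 'a \<Rightarrow> real) \<Rightarrow> bool" where
  "slow_solution M \<alpha> G Y X \<longleftrightarrow>
     (\<forall>t\<ge>0. X t \<in> borel_measurable M) \<and>
     (AE \<omega> in M. \<forall>t\<ge>0. X t \<omega> = X 0 \<omega> + \<alpha> * (LBINT s:{0..t}. G (Y s \<omega>)))"

definition estimator ::
  "real \<Rightarrow> nat \<Rightarrow> real \<Rightarrow> (real \<Rightarrow> 'a \<Rightarrow> real) \<Rightarrow> 'a \<Rightarrow> real" where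
  "estimator h N \<delta> X \<omega> =
     (if h > 1 / 2 then real N powr (2 * h - 1) else 1) *
     (\<Sum>i<N. (X (real (i + 1) * \<delta>) \<omega> - X (real i * \<delta>) \<omega>)\<^sup>2)"

end

theory Submission
  imports Defs "HOL-Real_Asymp.Real_Asymp"
begin

text \<open>
  For a fixed \<open>\<epsilon>\<close> the fast variable \<open>Y t\<close> is standard normal at every time, so by the
  Cauchy--Schwarz inequality in time and Tonelli's theorem an increment of the slow variable over a
  step \<open>\<delta>\<close> has second moment at most \<open>\<alpha>\<^sup>2 \<delta>\<^sup>2 K\<close>, where \<open>K\<close> is the squared
  norm of \<open>G\<close> in \<open>L\<^sup>2(\<gamma>)\<close>. Summing the \<open>N = T / \<delta>\<close> increments and inserting the
  scaling gives a bound by \<open>K T (\<delta> / \<epsilon>)\<close> when \<open>H\<^sup>* \<le> 1/2\<close> and \<open>\<epsilon> < 1/e\<close>, and by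
  \<open>K T powr (2 H\<^sup>*) * (\<delta> / \<epsilon>) powr (2 - 2 H\<^sup>*)\<close> when \<open>H\<^sup>* > 1/2\<close>. Since
  \<open>H\<^sup>* = 1 - (1 - H) m < 1\<close>, the last exponent is positive, and both bounds vanish with
  \<open>\<delta> / \<epsilon>\<close> (\<open>slow_increment_second_moment\<close>, \<open>estimator_bound\<close>, \<open>estimator_rate\<close>).

  The main work is the marginal law of \<open>Y\<close> (\<open>stationary_fou_marginal\<close>), which has to be derived
  from the equation and stationarity. Write \<open>l = 1 / \<epsilon>\<close> and \<open>c = \<sigma> / \<epsilon>\<^sup>H\<close>. The equation is solved
  pathwise for \<open>Y - c B\<close>, whose paths are continuously differentiable; this expresses \<open>Y 0\<close>
  through the values at time \<open>-n\<close>, damped by \<open>exp (- l n)\<close>, and the average of \<open>B (- u)\<close> over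
  \<open>0 \<le> u \<le> n\<close> against the exponential density of rate \<open>l\<close>. Stationarity keeps the law of \<open>Y (- n)\<close>
  fixed, so the damped terms disappear in probability and almost surely
  \<open>Y 0 = - c W\<close> with \<open>W\<close> the average of \<open>B (- u)\<close> over an exponentially distributed \<open>u\<close>.
  This \<open>W\<close> is a limit of finite linear combinations of values of \<open>B\<close>, hence centred Gaussian. If
  \<open>U\<close> and \<open>V\<close> are independent exponential variables of rate \<open>l\<close>, its variance is the mean of the
  covariance of \<open>B (- U)\<close> and \<open>B (- V)\<close>. Now \<open>\<bar>U - V\<bar>\<close> has the same law as \<open>U\<close>, so the
  three powers in the covariance have the same mean, and the variance is
  \<open>\<Gamma>(2H+1) / (2 l powr (2H))\<close>. This is the reciprocal of \<open>c\<^sup>2\<close> by the choice of \<open>\<sigma>\<close>.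
\<close>

section \<open>Processes with continuous paths\<close>

text \<open>By continuity the process is the pointwise limit of its values
  at the grid point just before \<open>t\<close>, and these involve only countably many random variables.\<close>

lemma borel_measurable_continuous_paths:
  fixes Z :: "real \<Rightarrow> 'a \<Rightarrow> real"
  assumes meas: "\<And>t. Z t \<in> borel_measurable M"
    and cont: "\<And>\<omega>. \<omega> \<in> space M \<Longrightarrow> continuous_on UNIV (\<lambda>t. Z t \<omega>)"
  shows "(\<lambda>p. Z (snd p) (fst p)) \<in> borel_measurable (M \<Otimes>\<^sub>M borel)"
proof (rule borel_measurable_LIMSEQ_real)
  define u where "u n p = Z (of_int \<lfloor>real (Suc n) * snd p\<rfloor> / real (Suc n)) (fst p)"
    for n and p :: "'a \<times> real"
  show "u n \<in> borel_measurable (M \<Otimes>\<^sub>M borel)" for n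
  proof -
    have "(\<lambda>p. (\<lambda>(i::int) p. Z (of_int i / real (Suc n)) (fst p)) \<lfloor>real (Suc n) * snd p\<rfloor> p)
        \<in> borel_measurable (M \<Otimes>\<^sub>M borel)"
      by (rule measurable_compose_countable)
        (auto intro!: measurable_compose[OF measurable_fst meas])
    then show ?thesis by (simp add: u_def[abs_def])
  qed
  show "(\<lambda>n. u n p) \<longlonglongrightarrow> Z (snd p) (fst p)" if "p \<in> space (M \<Otimes>\<^sub>M borel)" for p
  proof -
    have "(\<lambda>n. of_int \<lfloor>real (Suc n) * snd p\<rfloor> / real (Suc n)) \<longlonglongrightarrow> snd p"
    proof (rule tendsto_sandwich[OF _ _ _ tendsto_const])
      show "\<forall>\<^sub>F n in sequentially. snd p - 1 / real (Suc n) \<le> of_int \<lfloor>real (Suc n) * snd p\<rfloor> / real (Suc n)"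
      proof (intro always_eventually allI)
        fix n
        have "real (Suc n) * snd p - 1 \<le> of_int \<lfloor>real (Suc n) * snd p\<rfloor>" by linarith
        then have "(real (Suc n) * snd p - 1) / real (Suc n) \<le> of_int \<lfloor>real (Suc n) * snd p\<rfloor> / real (Suc n)"
          by (rule divide_right_mono) simp
        then show "snd p - 1 / real (Suc n) \<le> of_int \<lfloor>real (Suc n) * snd p\<rfloor> / real (Suc n)"
          by (simp add: diff_divide_distrib)
      qed
      show "\<forall>\<^sub>F n in sequentially. of_int \<lfloor>real (Suc n) * snd p\<rfloor> / real (Suc n) \<le> snd p"
        by (intro always_eventually allI) (simp add: divide_le_eq mult.commute)
      have "(\<lambda>n. snd p - 1 / real (Suc n)) \<longlonglongrightarrow> snd p - 0"
        by (intro tendsto_diff tendsto_const LIMSEQ_Suc[OF lim_1_over_n])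
      then show "(\<lambda>n. snd p - 1 / real (Suc n)) \<longlonglongrightarrow> snd p" by simp
    qed
    moreover have "isCont (\<lambda>t. Z t (fst p)) (snd p)"
      using cont[of "fst p"] that by (auto simp: space_pair_measure continuous_on_eq_continuous_at)
    ultimately show ?thesis
      unfolding u_def using isCont_tendsto_compose by blast
  qed
qed

text \<open>The exceptional set of paths need not be measurable, so it is enlarged to a null set and the
  process is replaced by zero there. Fubini arguments can then use every path.\<close>

lemma continuous_modification:
  fixes Z :: "real \<Rightarrow> 'a \<Rightarrow> real"
  assumes meas: "\<And>t. Z t \<in> borel_measurable M"
    and cont: "AE \<omega> in M. continuous_on UNIV (\<lambda>t. Z t \<omega>)"
  shows "\<exists>Z'. (\<forall>t. Z' t \<in> borel_measurable M) \<and> (\<forall>\<omega>. continuous_on UNIV (\<lambda>t. Z' t \<omega>)) \<and>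
    (AE \<omega> in M. \<forall>t. Z' t \<omega> = Z t \<omega>)"
proof -
  obtain C where C: "{\<omega> \<in> space M. \<not> continuous_on UNIV (\<lambda>t. Z t \<omega>)} \<subseteq> C" "C \<in> null_sets M"
    using cont by (auto elim!: AE_E)
  define Z' where "Z' t \<omega> = (if \<omega> \<in> space M - C then Z t \<omega> else 0)" for t \<omega>
  have [measurable]: "C \<in> sets M" using C by auto
  have 1: "Z' t \<in> borel_measurable M" for t
    unfolding Z'_def[abs_def] using meas[of t] by measurable
  have 2: "continuous_on UNIV (\<lambda>t. Z' t \<omega>)" for \<omega>
    unfolding Z'_def using C(1) by (cases "\<omega> \<in> space M - C") auto
  have 3: "AE \<omega> in M. \<forall>t. Z' t \<omega> = Z t \<omega>"
    using AE_not_in[OF C(2)] by (auto simp: Z'_def)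
  show ?thesis
    using 1 2 3 by (intro exI[of _ Z'] conjI allI)
qed

section \<open>Centred Gaussian variables\<close>

lemma integral_std_normal_shift:
  "(LINT x|std_normal_distribution. \<mu> + s * x) = \<mu>"
  "integrable std_normal_distribution (\<lambda>x. \<mu> + s * x)"
proof -
  interpret prob_space std_normal_distribution by (rule prob_space_normal_density) simp
  have "integrable std_normal_distribution (\<lambda>x. x ^ 1)"
    using integrable_std_normal_distribution_moment[of 1] by simp
  moreover have "(LINT x|std_normal_distribution. x) = 0"
    using integral_std_normal_distribution_moment_odd[of 1] by simp
  moreover have "prob UNIV = 1" using prob_space by simp
  ultimately show "(LINT x|std_normal_distribution. \<mu> + s * x) = \<mu>"
     "integrable std_normal_distribution (\<lambda>x. \<mu> + s * x)"
    by auto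
qed

text \<open>A description that covers the degenerate case \<open>s = 0\<close> as well, so that moments of Gaussian
  variables reduce to moments of the standard normal law without case distinctions.\<close>

lemma gaussian_rv_affine:
  assumes "gaussian_rv M Z"
  obtains \<mu> s where "distr M borel Z = distr std_normal_distribution borel (\<lambda>x. \<mu> + s * x)"
proof -
  interpret N: prob_space std_normal_distribution by (rule prob_space_normal_density) simp
  obtain \<mu> s where s: "s \<ge> 0" and d: "distr M borel Z =
       (if s = 0 then return borel \<mu> else density lborel (\<lambda>x. ennreal (normal_density \<mu> s x)))"
    using assms by (auto simp: gaussian_rv_def)
  have "distr M borel Z = distr std_normal_distribution borel (\<lambda>x. \<mu> + s * x)"
  proof (cases "s = 0")
    case True
    have "distr std_normal_distribution borel (\<lambda>x. \<mu>) = return borel \<mu>"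
      by (intro measure_eqI) (auto simp: emeasure_distr N.emeasure_space_1 split: split_indicator)
    then show ?thesis using True d by simp
  next
    case False
    have "distributed std_normal_distribution lborel (\<lambda>x. x) std_normal_density"
      by (auto simp: distributed_def distr_id2)
    from N.normal_density_affine[OF this, of s \<mu>] False s
    have "distributed std_normal_distribution lborel (\<lambda>x. \<mu> + s * x) (normal_density \<mu> s)" by simp
    then have "distr std_normal_distribution lborel (\<lambda>x. \<mu> + s * x) = density lborel (normal_density \<mu> s)"
      by (simp add: distributed_def)
    moreover have "distr std_normal_distribution lborel (\<lambda>x. \<mu> + s * x)
        = distr std_normal_distribution borel (\<lambda>x. \<mu> + s * x)"
      by (intro distr_cong) auto
    ultimately show ?thesis using d False by simp
  qed
  then show ?thesis by (rule that)
qed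

text \<open>Described through the characteristic function, so that limits are easy to take.\<close>

definition centred_gaussian :: "'a measure \<Rightarrow> ('a \<Rightarrow> real) \<Rightarrow> bool" where
  "centred_gaussian M Z \<longleftrightarrow> Z \<in> borel_measurable M \<and>
     (\<exists>s\<ge>0. \<forall>u. char (distr M borel Z) u = complex_of_real (exp (- ((s * u)\<^sup>2) / 2)))"

lemma char_std_normal_scaled:
  "char (distr std_normal_distribution borel (\<lambda>x. s * x)) u = complex_of_real (exp (- ((s * u)\<^sup>2) / 2))"
proof -
  have "char (distr std_normal_distribution borel (\<lambda>x. s * x)) u = char std_normal_distribution (s * u)"
    by (simp add: char_def integral_distr mult_ac)
  then show ?thesis by (simp add: char_std_normal_distribution)
qed

lemma (in prob_space) centred_gaussian_distr:
  assumes "centred_gaussian M Z"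
  obtains s where "s \<ge> 0" "distr M borel Z = distr std_normal_distribution borel (\<lambda>x. s * x)"
proof -
  interpret N: prob_space std_normal_distribution by (rule prob_space_normal_density) simp
  obtain s where [measurable]: "Z \<in> borel_measurable M"
    and s: "s \<ge> 0" "\<And>u. char (distr M borel Z) u = complex_of_real (exp (- ((s * u)\<^sup>2) / 2))"
    using assms by (auto simp: centred_gaussian_def)
  have "distr M borel Z = distr std_normal_distribution borel (\<lambda>x. s * x)"
    by (rule Levy_uniqueness)
      (auto simp: char_std_normal_scaled s intro!: real_distribution_distr N.real_distribution_distr)
  with s show ?thesis by (intro that)
qed

lemma (in prob_space) gaussian_rv_imp_centred_gaussian:
  assumes "gaussian_rv M Z" "expectation Z = 0"
  shows "centred_gaussian M Z"
proof -
  obtain \<mu> s where d: "distr M borel Z = distr std_normal_distribution borel (\<lambda>x. \<mu> + s * x)"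
    using gaussian_rv_affine[OF assms(1)] .
  have [measurable]: "Z \<in> borel_measurable M" using assms(1) by (simp add: gaussian_rv_def)
  have "expectation Z = (LINT x|distr M borel Z. x)" by (simp add: integral_distr)
  also have "\<dots> = \<mu>" by (simp add: d integral_distr integral_std_normal_shift)
  finally have "\<mu> = 0" using assms(2) by simp
  then have "char (distr M borel Z) u = complex_of_real (exp (- ((\<bar>s\<bar> * u)\<^sup>2) / 2))" for u
    by (simp add: d char_std_normal_scaled power_mult_distrib)
  then show ?thesis unfolding centred_gaussian_def by (intro conjI exI[of _ "\<bar>s\<bar>"]) auto
qed

lemma (in prob_space) gaussian_rv_square_integrable:
  assumes "gaussian_rv M Z"
  shows "integrable M Z" "integrable M (\<lambda>\<omega>. (Z \<omega>)\<^sup>2)"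
proof -
  interpret N: prob_space std_normal_distribution by (rule prob_space_normal_density) simp
  obtain \<mu> s where d: "distr M borel Z = distr std_normal_distribution borel (\<lambda>x. \<mu> + s * x)"
    using gaussian_rv_affine[OF assms(1)] .
  have [measurable]: "Z \<in> borel_measurable M" using assms(1) by (simp add: gaussian_rv_def)
  have i: "integrable std_normal_distribution (\<lambda>x. (\<mu> + s * x)\<^sup>2)"
  proof -
    have "integrable std_normal_distribution (\<lambda>x. \<mu>\<^sup>2 + 2 * \<mu> * s * x ^ 1 + s\<^sup>2 * x\<^sup>2)"
      using integrable_std_normal_distribution_moment[of 1] integrable_std_normal_distribution_moment[of 2]
      by (intro Bochner_Integration.integrable_add integrable_mult_right) auto
    then show ?thesis by (simp add: power2_eq_square algebra_simps)
  qed
  have "integrable (distr M borel Z) (\<lambda>x. x)"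
    unfolding d by (subst integrable_distr_eq) (auto intro: integral_std_normal_shift(2))
  then show "integrable M Z" by (subst (asm) integrable_distr_eq) auto
  have "integrable (distr M borel Z) (\<lambda>x. x\<^sup>2)"
    unfolding d by (subst integrable_distr_eq) (auto intro: i)
  then show "integrable M (\<lambda>\<omega>. (Z \<omega>)\<^sup>2)" by (subst (asm) integrable_distr_eq) auto
qed

lemma (in prob_space) centred_gaussian_moments:
  assumes "centred_gaussian M Z"
  shows "integrable M (\<lambda>\<omega>. (Z \<omega>)\<^sup>2)"
    and "distr M borel Z = distr std_normal_distribution borel (\<lambda>x. sqrt (expectation (\<lambda>\<omega>. (Z \<omega>)\<^sup>2)) * x)"
proof -
  obtain s where s: "s \<ge> 0" and d: "distr M borel Z = distr std_normal_distribution borel (\<lambda>x. s * x)"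
    using centred_gaussian_distr[OF assms(1)] .
  have [measurable]: "Z \<in> borel_measurable M" using assms(1) by (simp add: centred_gaussian_def)
  have "integrable (distr M borel Z) (\<lambda>x. x\<^sup>2)"
    unfolding d using integrable_std_normal_distribution_moment[of 2]
    by (subst integrable_distr_eq) (auto simp: power_mult_distrib)
  then show "integrable M (\<lambda>\<omega>. (Z \<omega>)\<^sup>2)" by (subst (asm) integrable_distr_eq) auto
  have "expectation (\<lambda>\<omega>. (Z \<omega>)\<^sup>2) = (LINT x|distr M borel Z. x\<^sup>2)" by (simp add: integral_distr)
  also have "\<dots> = s\<^sup>2 * (LINT x|std_normal_distribution. x\<^sup>2)"
    by (simp add: d integral_distr power_mult_distrib)
  also have "(LINT x|std_normal_distribution. x\<^sup>2) = 1"
    using std_normal_distribution_even_moments(1)[of 1] by simp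
  finally have "sqrt (expectation (\<lambda>\<omega>. (Z \<omega>)\<^sup>2)) = s" using s by simp
  then show "distr M borel Z = distr std_normal_distribution borel (\<lambda>x. sqrt (expectation (\<lambda>\<omega>. (Z \<omega>)\<^sup>2)) * x)"
    using d by simp
qed

lemma (in prob_space) char_AE_limit:
  assumes [measurable]: "\<And>n. Z n \<in> borel_measurable M" "W \<in> borel_measurable M"
    and lim: "AE \<omega> in M. (\<lambda>n. Z n \<omega>) \<longlonglongrightarrow> W \<omega>"
  shows "(\<lambda>n. char (distr M borel (Z n)) u) \<longlonglongrightarrow> char (distr M borel W) u"
proof -
  have "(\<lambda>n. CLINT \<omega>|M. iexp (u * Z n \<omega>)) \<longlonglongrightarrow> (CLINT \<omega>|M. iexp (u * W \<omega>))"
  proof (rule integral_dominated_convergence[where w = "\<lambda>_. 1"])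
    show "AE \<omega> in M. (\<lambda>n. iexp (u * Z n \<omega>)) \<longlonglongrightarrow> iexp (u * W \<omega>)"
      using lim by eventually_elim (intro tendsto_intros)
  qed auto
  then show ?thesis by (simp add: char_def integral_distr)
qed

text \<open>Characteristic functions converge along an almost sure limit, and those of centred Gaussian
  variables are determined by the variance. So the variances must converge.\<close>

lemma (in prob_space) centred_gaussian_AE_limit:
  assumes g: "\<And>n. centred_gaussian M (Z n)" and [measurable]: "W \<in> borel_measurable M"
    and lim: "AE \<omega> in M. (\<lambda>n. Z n \<omega>) \<longlonglongrightarrow> W \<omega>"
  shows "centred_gaussian M W"
proof -
  have [measurable]: "Z n \<in> borel_measurable M" for n using g[of n] by (simp add: centred_gaussian_def)
  interpret W: real_distribution "distr M borel W" by (rule real_distribution_distr) simp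
  from g obtain s where s: "\<And>n. s n \<ge> 0"
    "\<And>n u. char (distr M borel (Z n)) u = complex_of_real (exp (- ((s n * u)\<^sup>2) / 2))"
    unfolding centred_gaussian_def by metis
  have conv: "(\<lambda>n. complex_of_real (exp (- ((s n * u)\<^sup>2) / 2))) \<longlonglongrightarrow> char (distr M borel W) u" for u
    using char_AE_limit[OF _ _ lim, of u] by (simp add: s)
  define r where "r u = Re (char (distr M borel W) u)" for u
  have conv': "(\<lambda>n. exp (- ((s n * u)\<^sup>2) / 2)) \<longlonglongrightarrow> r u" for u
    using tendsto_Re[OF conv[of u]] by (simp add: r_def)
  have real: "char (distr M borel W) u = complex_of_real (r u)" for u
    using tendsto_of_real[OF conv'[of u], where 'a = complex] conv[of u] LIMSEQ_unique by blast
  \<comment> \<open>The limit is continuous and equals one at zero, so it is positive somewhere off zero; this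
    keeps the variances from escaping to infinity.\<close>
  have "isCont r 0" unfolding r_def using W.isCont_char[of 0] by (intro isCont_Re)
  moreover have "r 0 = 1" using W.char_zero by (simp add: r_def)
  ultimately have "(r \<longlongrightarrow> 1) (at 0)" by (simp add: isCont_def)
  then have "\<forall>\<^sub>F u in at 0. r u > 0" by (rule order_tendstoD) simp
  then obtain d where d: "d > 0" "\<And>u. u \<noteq> 0 \<Longrightarrow> dist u 0 < d \<Longrightarrow> r u > 0"
    unfolding eventually_at by auto
  define a where "a = d / 2"
  have a: "a > 0" "r a > 0" using d(1) d(2)[of a] by (auto simp: a_def)
  have "(\<lambda>n. ln (exp (- ((s n * a)\<^sup>2) / 2))) \<longlonglongrightarrow> ln (r a)"
    using a(2) by (intro tendsto_ln conv') auto
  then have "(\<lambda>n. (- 2 / a\<^sup>2) * (- ((s n * a)\<^sup>2) / 2)) \<longlonglongrightarrow> (- 2 / a\<^sup>2) * ln (r a)"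
    by (intro tendsto_mult_left) simp
  then have v: "(\<lambda>n. (s n)\<^sup>2) \<longlonglongrightarrow> (- 2 / a\<^sup>2) * ln (r a)"
    using a(1) by (simp add: power_mult_distrib)
  define v where "v = (- 2 / a\<^sup>2) * ln (r a)"
  have "v \<ge> 0" unfolding v_def by (rule LIMSEQ_le_const[OF v]) auto
  have "char (distr M borel W) u = complex_of_real (exp (- ((sqrt v * u)\<^sup>2) / 2))" for u
  proof -
    have "(\<lambda>n. exp (- ((s n)\<^sup>2 * u\<^sup>2) / 2)) \<longlonglongrightarrow> exp (- (v * u\<^sup>2) / 2)"
      using v by (intro tendsto_intros) (auto simp: v_def)
    then have "r u = exp (- (v * u\<^sup>2) / 2)"
      using conv'[of u] LIMSEQ_unique by (simp add: power_mult_distrib) blast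
    then show ?thesis using real \<open>v \<ge> 0\<close> by (simp add: power_mult_distrib)
  qed
  then show ?thesis unfolding centred_gaussian_def using \<open>v \<ge> 0\<close> by (intro conjI exI[of _ "sqrt v"]) auto
qed

section \<open>The Ornstein--Uhlenbeck equation and the exponential law\<close>

abbreviation exp_law :: "real \<Rightarrow> real measure" where
  "exp_law l \<equiv> density lborel (exponential_density l)"

lemma integral_exp_law:
  fixes f :: "real \<Rightarrow> real"
  assumes [measurable]: "f \<in> borel_measurable borel" and "l > 0"
  shows "(LINT u|exp_law l. f u) = (LBINT u. exponential_density l u * f u)"
  using assms by (subst integral_density) (auto simp: exponential_density_nonneg)

text \<open>The noise path \<open>b\<close> is merely continuous, but \<open>w = y - c b\<close> is differentiable with
  \<open>w' = - l y = - l (w + c b)\<close>. Solving this linear equation for \<open>w\<close> backwards from \<open>0\<close> to \<open>- T\<close>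
  amounts to an integration by parts in the Wiener integral of an exponential against \<open>b\<close>.\<close>

lemma ou_variation_of_constants:
  fixes y b :: "real \<Rightarrow> real"
  assumes y: "continuous_on UNIV y" and b: "continuous_on UNIV b"
    and eq: "\<And>s t. s \<le> t \<Longrightarrow> y t - y s = - l * (LBINT r:{s..t}. y r) + c * (b t - b s)"
    and l: "l > 0" and T: "T \<ge> 0"
  shows "y 0 - c * b 0 = exp (- l * T) * (y (- T) - c * b (- T))
    - c * (LINT u|exp_law l. indicator {0..T} u * b (- u))"
proof -
  define w where "w t = y t - c * b t" for t
  define a where "a = - T - 1"
  have w_eq: "w t = w a - l * integral {a..t} y" if "t \<ge> a" for t
  proof -
    have "set_integrable lborel {a..t} y"
      by (intro borel_integrable_atLeastAtMost' continuous_on_subset[OF y]) auto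
    from set_borel_integral_eq_integral(2)[OF this] eq[OF that] show ?thesis
      by (simp add: w_def algebra_simps)
  qed
  have w_deriv: "(w has_real_derivative - l * y t) (at t)" if t: "t \<in> {-T..0}" for t
  proof -
    have "((\<lambda>x. integral {a..x} y) has_real_derivative y t) (at t within {a..1})"
      using t continuous_on_subset[OF y subset_UNIV] by (intro integral_has_real_derivative) (simp_all add: a_def)
    then have "((\<lambda>x. integral {a..x} y) has_real_derivative y t) (at t)"
      using t at_within_Icc_at[of a t 1] by (simp add: a_def)
    then have "((\<lambda>x. w a - l * integral {a..x} y) has_real_derivative - l * y t) (at t)"
      by (auto intro!: derivative_eq_intros)
    moreover have "\<forall>\<^sub>F x in nhds t. w x = w a - l * integral {a..x} y"
    proof (rule eventually_mono)
      show "\<forall>\<^sub>F x in nhds t. x \<in> {a<..}"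
        using t by (intro eventually_nhds_in_open) (auto simp: a_def)
      show "w x = w a - l * integral {a..x} y" if "x \<in> {a<..}" for x
        using that by (intro w_eq) simp
    qed
    ultimately show ?thesis by (subst DERIV_cong_ev[OF refl _ refl]) auto
  qed
  \<comment> \<open>The integrating factor, with time reversed to match the exponential density on \<open>[0, T]\<close>.\<close>
  define F where "F u = exp (- l * u) * w (- u)" for u
  have F_deriv: "(F has_real_derivative l * exp (- l * u) * c * b (- u)) (at u)" if "0 \<le> u" "u \<le> T" for u
  proof -
    have "((\<lambda>u. w (- u)) has_real_derivative (- l * y (- u)) * (- 1)) (at u)"
      using that by (intro DERIV_chain2[where f = w] w_deriv) (auto intro!: derivative_eq_intros)
    then have "(F has_real_derivative exp (- l * u) * (- l) * w (- u) + exp (- l * u) * (l * y (- u))) (at u)"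
      unfolding F_def by (auto intro!: derivative_eq_intros)
    then show ?thesis by (simp add: w_def algebra_simps)
  qed
  have b': "continuous_on UNIV (\<lambda>u. b (- u))"
    by (intro continuous_on_compose2[OF b] continuous_intros) auto
  have [measurable]: "(\<lambda>u. b (- u)) \<in> borel_measurable borel"
    by (rule borel_measurable_continuous_onI[OF b'])
  have "(LBINT u. l * exp (- l * u) * c * b (- u) * indicator {0..T} u) = F T - F 0"
  proof (rule integral_FTC_Icc_real[OF T F_deriv])
    show "isCont (\<lambda>u. l * exp (- l * u) * c * b (- u)) u" for u
      using b' by (intro continuous_intros) (auto simp: continuous_on_eq_continuous_at)
  qed
  also have "(LBINT u. l * exp (- l * u) * c * b (- u) * indicator {0..T} u)
      = (LBINT u. c * (exponential_density l u * (indicator {0..T} u * b (- u))))"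
    by (intro Bochner_Integration.integral_cong)
      (auto simp: exponential_density_def indicator_def mult_ac)
  also have "\<dots> = c * (LINT u|exp_law l. indicator {0..T} u * b (- u))"
    by (subst integral_exp_law) (auto simp: l)
  finally show ?thesis by (simp add: F_def w_def algebra_simps)
qed

lemma nn_integral_exp_law:
  assumes [measurable]: "f \<in> borel_measurable borel" and "l > 0"
  shows "(\<integral>\<^sup>+u. f u \<partial>exp_law l) = (\<integral>\<^sup>+u. ennreal (exponential_density l u) * f u \<partial>lborel)"
  by (subst nn_integral_density) auto

lemma exp_law_moment:
  fixes l p :: real
  assumes l: "l > 0" and p: "p > 0"
  shows "(\<integral>\<^sup>+u. ennreal (\<bar>u\<bar> powr p) \<partial>exp_law l) = ennreal (Gamma (p + 1) / l powr p)"
proof -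
  have "ennreal (Gamma (p + 1)) = (\<integral>\<^sup>+t. ennreal (indicator {0..} t * t powr p / exp t) \<partial>lborel)"
    using Gamma_conv_nn_integral_real[of "p + 1"] p by simp
  also have "\<dots> = ennreal l * (\<integral>\<^sup>+u. ennreal (indicator {0..} (l * u) * (l * u) powr p / exp (l * u)) \<partial>lborel)"
    using l by (subst nn_integral_real_affine[where c = l and t = 0]) auto
  also have "\<dots> = (\<integral>\<^sup>+u. ennreal (l powr p) * (ennreal (exponential_density l u) * ennreal (\<bar>u\<bar> powr p)) \<partial>lborel)"
    using l by (subst nn_integral_cmult[symmetric])
      (auto intro!: nn_integral_cong simp: exponential_density_def indicator_def ennreal_mult'[symmetric]
         zero_le_mult_iff powr_mult exp_minus field_simps)
  also have "\<dots> = ennreal (l powr p) * (\<integral>\<^sup>+u. ennreal (\<bar>u\<bar> powr p) \<partial>exp_law l)"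
    using l by (subst nn_integral_cmult) (auto simp: nn_integral_exp_law)
  finally have *: "ennreal (Gamma (p + 1)) = ennreal (l powr p) * (\<integral>\<^sup>+u. ennreal (\<bar>u\<bar> powr p) \<partial>exp_law l)" .
  have "ennreal (Gamma (p + 1) / l powr p) = ennreal (1 / l powr p) * ennreal (Gamma (p + 1))"
    using l by (subst ennreal_mult'[symmetric]) auto
  also have "\<dots> = (ennreal (1 / l powr p) * ennreal (l powr p)) * (\<integral>\<^sup>+u. ennreal (\<bar>u\<bar> powr p) \<partial>exp_law l)"
    by (simp add: * mult.assoc)
  also have "ennreal (1 / l powr p) * ennreal (l powr p) = 1"
    using l by (subst ennreal_mult'[symmetric]) auto
  finally show ?thesis by simp
qed

lemma exponential_tail:
  fixes k a :: real
  assumes k: "k > 0"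
  shows "(\<integral>\<^sup>+v. ennreal (k * exp (- k * v)) * indicator {a..} v \<partial>lborel) = ennreal (exp (- k * a))"
proof -
  have "((\<lambda>v. - exp (- k * v)) \<longlongrightarrow> - 0) at_top"
    using k by (intro tendsto_minus filterlim_compose[OF exp_at_bot]
        filterlim_tendsto_neg_mult_at_bot[OF tendsto_const _ filterlim_ident]) auto
  then have "(\<integral>\<^sup>+v. ennreal (k * exp (- k * v)) * indicator {a..} v \<partial>lborel) = 0 - (- exp (- k * a))"
    using k by (intro nn_integral_FTC_atLeast) (auto intro!: derivative_eq_intros)
  then show ?thesis by simp
qed

text \<open>The difference of two independent exponential variables has the Laplace density. In the
  convolution \<open>v\<close> ranges over \<open>v \<ge> max 0 (- w)\<close>, which leaves an exponential tail of rate \<open>2 l\<close>.\<close>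

lemma exponential_difference_density:
  fixes l w :: real
  assumes l: "l > 0"
  shows "(\<integral>\<^sup>+v. ennreal (exponential_density l v) * ennreal (exponential_density l (v + w)) \<partial>lborel)
    = ennreal (l / 2 * exp (- l * \<bar>w\<bar>))"
proof -
  define a where "a = max 0 (- w)"
  have "(\<integral>\<^sup>+v. ennreal (exponential_density l v) * ennreal (exponential_density l (v + w)) \<partial>lborel)
     = (\<integral>\<^sup>+v. ennreal (l / 2 * exp (- l * w)) * (ennreal ((2 * l) * exp (- (2 * l) * v)) * indicator {a..} v) \<partial>lborel)"
  proof (intro nn_integral_cong)
    fix v
    have "exp (- (v * l)) * exp ((- v - w) * l) = exp (- (l * w)) * exp (- (2 * l * v))"
      by (simp add: exp_add[symmetric] algebra_simps)
    then have "exponential_density l v * exponential_density l (v + w)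
      = l / 2 * exp (- l * w) * ((2 * l) * exp (- (2 * l) * v) * indicator {a..} v)"
      by (auto simp: exponential_density_def indicator_def a_def)
    moreover have "ennreal ((2 * l) * exp (- (2 * l) * v)) * indicator {a..} v
      = ennreal ((2 * l) * exp (- (2 * l) * v) * indicator {a..} v)"
      by (simp split: split_indicator)
    ultimately show "ennreal (exponential_density l v) * ennreal (exponential_density l (v + w))
      = ennreal (l / 2 * exp (- l * w)) * (ennreal ((2 * l) * exp (- (2 * l) * v)) * indicator {a..} v)"
      using l by (simp only:) (subst ennreal_mult'[symmetric], auto simp: exponential_density_nonneg)+
  qed
  also have "\<dots> = ennreal (l / 2 * exp (- l * w)) * ennreal (exp (- (2 * l) * a))"
    using exponential_tail[of "2 * l" a] l by (subst nn_integral_cmult) (simp_all del: mult_minus_left)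
  also have "\<dots> = ennreal (l / 2 * exp (- l * \<bar>w\<bar>))"
    using l by (auto simp: ennreal_mult'[symmetric] exp_add[symmetric] a_def max_def abs_if)
  finally show ?thesis .
qed

text \<open>The absolute difference of two independent exponential variables has the same law as each of
  them (after the smaller one, the remaining waiting time is again exponential), which is why the
  value agrees with that in \<open>exp_law_moment\<close>.\<close>

lemma exp_law_difference_moment:
  fixes l p :: real
  assumes l: "l > 0" and p: "p > 0"
  shows "(\<integral>\<^sup>+v. (\<integral>\<^sup>+u. ennreal (\<bar>u - v\<bar> powr p) \<partial>exp_law l) \<partial>exp_law l) = ennreal (Gamma (p + 1) / l powr p)"
proof -
  let ?e = "\<lambda>u. ennreal (exponential_density l u)"
  let ?g = "\<lambda>w::real. ennreal (\<bar>w\<bar> powr p)"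
  have "(\<integral>\<^sup>+v. (\<integral>\<^sup>+u. ?g (u - v) \<partial>exp_law l) \<partial>exp_law l)
     = (\<integral>\<^sup>+v. ?e v * (\<integral>\<^sup>+u. ?e u * ?g (u - v) \<partial>lborel) \<partial>lborel)"
    using l by (simp add: nn_integral_exp_law)
  also have "\<dots> = (\<integral>\<^sup>+v. ?e v * (\<integral>\<^sup>+w. ?e (v + w) * ?g w \<partial>lborel) \<partial>lborel)"
  proof (rule nn_integral_cong)
    fix v
    have "(\<integral>\<^sup>+u. ?e u * ?g (u - v) \<partial>lborel) = (\<integral>\<^sup>+w. ?e (v + w) * ?g w \<partial>lborel)"
      by (subst nn_integral_real_affine[where c = 1 and t = v]) auto
    then show "?e v * (\<integral>\<^sup>+u. ?e u * ?g (u - v) \<partial>lborel) = ?e v * (\<integral>\<^sup>+w. ?e (v + w) * ?g w \<partial>lborel)"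
      by simp
  qed
  also have "\<dots> = (\<integral>\<^sup>+v. (\<integral>\<^sup>+w. ?g w * (?e v * ?e (v + w)) \<partial>lborel) \<partial>lborel)"
    by (subst nn_integral_cmult[symmetric]) (auto simp: mult_ac)
  also have "\<dots> = (\<integral>\<^sup>+w. (\<integral>\<^sup>+v. ?g w * (?e v * ?e (v + w)) \<partial>lborel) \<partial>lborel)"
    by (rule lborel_pair.Fubini') measurable
  also have "\<dots> = (\<integral>\<^sup>+w. ?g w * ennreal (l / 2 * exp (- l * \<bar>w\<bar>)) \<partial>lborel)"
    by (subst nn_integral_cmult) (auto simp: exponential_difference_density l)
  also have "\<dots> = (\<integral>\<^sup>+w. ennreal (1 / 2) * (?e w * ?g w + ?e (- w) * ?g (- w)) \<partial>lborel)"
  proof (rule nn_integral_cong)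
    fix w
    have "\<bar>w\<bar> powr p * (l / 2 * exp (- l * \<bar>w\<bar>))
      = 1 / 2 * (exponential_density l w * \<bar>w\<bar> powr p + exponential_density l (- w) * \<bar>- w\<bar> powr p)"
      using l p by (cases "w = 0") (auto simp: exponential_density_def abs_if mult_ac)
    then have "ennreal (\<bar>w\<bar> powr p * (l / 2 * exp (- l * \<bar>w\<bar>)))
      = ennreal (1 / 2) * ennreal (exponential_density l w * \<bar>w\<bar> powr p + exponential_density l (- w) * \<bar>- w\<bar> powr p)"
      by (simp only:) (rule ennreal_mult', simp)
    then show "?g w * ennreal (l / 2 * exp (- l * \<bar>w\<bar>)) = ennreal (1 / 2) * (?e w * ?g w + ?e (- w) * ?g (- w))"
      using l by (simp only: ennreal_mult' ennreal_plus exponential_density_nonneg mult_nonneg_nonneg powr_ge_zero)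
  qed
  also have "\<dots> = ennreal (1 / 2) * ((\<integral>\<^sup>+w. ?e w * ?g w \<partial>lborel) + (\<integral>\<^sup>+w. ?e (- w) * ?g (- w) \<partial>lborel))"
    by (subst nn_integral_cmult) (auto simp: nn_integral_add)
  also have "(\<integral>\<^sup>+w. ?e (- w) * ?g (- w) \<partial>lborel) = (\<integral>\<^sup>+w. ?e w * ?g w \<partial>lborel)"
    by (subst (2) nn_integral_real_affine[where c = "-1" and t = 0]) auto
  also have "(\<integral>\<^sup>+w. ?e w * ?g w \<partial>lborel) = ennreal (Gamma (p + 1) / l powr p)"
    using exp_law_moment[OF l p] l by (simp add: nn_integral_exp_law)
  also have "ennreal (1 / 2) * (ennreal (Gamma (p + 1) / l powr p) + ennreal (Gamma (p + 1) / l powr p))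
     = ennreal (Gamma (p + 1) / l powr p)"
  proof -
    have "ennreal (1 / 2) * (x + x) = (ennreal (1 / 2) + ennreal (1 / 2)) * x" for x
      by (simp only: distrib_left distrib_right)
    moreover have "ennreal (1 / 2) + ennreal (1 / 2) = 1"
      by (subst ennreal_plus[symmetric]) (auto simp del: ennreal_plus)
    ultimately show ?thesis by (simp only: mult_1)
  qed
  finally show ?thesis .
qed

section \<open>Exponential averages of fractional Brownian motion\<close>

locale continuous_fbm = prob_space M for M :: "'a measure" +
  fixes H :: real and B :: "real \<Rightarrow> 'a \<Rightarrow> real" and l :: real
  assumes H_pos: "0 < H" and l_pos: "0 < l"
    and fbm: "fractional_brownian_motion M H B"
    and paths: "\<And>\<omega>. continuous_on UNIV (\<lambda>t. B t \<omega>)"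
begin

sublocale L: prob_space "exp_law l"
  by (rule prob_space_exponential_density) (rule l_pos)

sublocale P: pair_prob_space M "exp_law l" ..

lemma gaussian_combination:
  "finite J \<Longrightarrow> gaussian_rv M (\<lambda>\<omega>. \<Sum>t\<in>J. a t * B t \<omega>)"
  using fbm by (auto simp: fractional_brownian_motion_def gaussian_process_def)

lemma gaussian_marginal: "gaussian_rv M (B t)"
  using gaussian_combination[of "{t}" "\<lambda>_. 1"] by simp

lemma measurable_B [measurable]: "B t \<in> borel_measurable M"
  using gaussian_marginal[of t] by (simp add: gaussian_rv_def)

lemma jointly_measurable_B: "(\<lambda>p. B (snd p) (fst p)) \<in> borel_measurable (M \<Otimes>\<^sub>M borel)"
  by (rule borel_measurable_continuous_paths[OF measurable_B paths])

lemma jointly_measurable_B_past [measurable]: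
  "(\<lambda>p. B (- snd p) (fst p)) \<in> borel_measurable (M \<Otimes>\<^sub>M borel)"
  using measurable_compose[OF _ jointly_measurable_B, of "\<lambda>p. (fst p, - snd p)"] by simp

lemma measurable_path [measurable]: "(\<lambda>u. B (- u) \<omega>) \<in> borel_measurable borel"
  by (intro borel_measurable_continuous_onI continuous_on_compose2[OF paths] continuous_intros) auto

lemma integrable_B: "integrable M (B t)" "integrable M (\<lambda>\<omega>. (B t \<omega>)\<^sup>2)"
  using gaussian_rv_square_integrable[OF gaussian_marginal] by auto

lemma expectation_B: "expectation (B t) = 0"
  using fbm by (simp add: fractional_brownian_motion_def)

lemma covariance_B:
  "expectation (\<lambda>\<omega>. B s \<omega> * B t \<omega>) =
    (\<bar>s\<bar> powr (2 * H) + \<bar>t\<bar> powr (2 * H) - \<bar>t - s\<bar> powr (2 * H)) / 2"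
  using fbm by (simp add: fractional_brownian_motion_def)

lemma variance_B: "expectation (\<lambda>\<omega>. (B t \<omega>)\<^sup>2) = \<bar>t\<bar> powr (2 * H)"
  using covariance_B[of t t] H_pos by (simp add: power2_eq_square)

lemma B_zero: "AE \<omega> in M. B 0 \<omega> = 0"
proof -
  have "expectation (\<lambda>\<omega>. (B 0 \<omega>)\<^sup>2) = 0" using variance_B[of 0] by simp
  then show ?thesis
    using integral_nonneg_eq_0_iff_AE[OF integrable_B(2)[of 0]] by simp
qed

text \<open>From \<open>\<bar>Q B\<bar> \<le> Q\<^sup>2 + B\<^sup>2\<close> the mean at lag \<open>u\<close> is at most a constant plus \<open>u powr (2 * H)\<close>, which
  has finite exponential moment. This justifies exchanging the expectation with the exponential
  average.\<close>

lemma integrable_weighted_field: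
  assumes [measurable]: "Q \<in> borel_measurable M" and Q: "integrable M (\<lambda>\<omega>. (Q \<omega>)\<^sup>2)"
  shows "integrable (M \<Otimes>\<^sub>M exp_law l) (\<lambda>p. Q (fst p) * B (- snd p) (fst p))"
proof (rule integrableI_bounded)
  have meas: "(\<lambda>p. Q (fst p) * B (- snd p) (fst p)) \<in> borel_measurable (M \<Otimes>\<^sub>M borel)"
    by measurable
  then show meas': "(\<lambda>p. Q (fst p) * B (- snd p) (fst p)) \<in> borel_measurable (M \<Otimes>\<^sub>M exp_law l)"
    by (subst measurable_cong_sets[OF sets_pair_measure_cong refl]) auto
  have inner: "(\<integral>\<^sup>+\<omega>. ennreal (norm (Q \<omega> * B (- u) \<omega>)) \<partial>M)
      \<le> ennreal (expectation (\<lambda>\<omega>. (Q \<omega>)\<^sup>2)) + ennreal (\<bar>u\<bar> powr (2 * H))" for u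
  proof -
    have le: "norm (x * y) \<le> x\<^sup>2 + y\<^sup>2" for x y :: real
    proof -
      have "2 * (\<bar>x\<bar> * \<bar>y\<bar>) \<le> x\<^sup>2 + y\<^sup>2"
        using sum_squares_bound[of "\<bar>x\<bar>" "\<bar>y\<bar>"] by (simp add: mult.assoc)
      moreover have "0 \<le> \<bar>x\<bar> * \<bar>y\<bar>" by simp
      ultimately show ?thesis unfolding real_norm_def abs_mult by linarith
    qed
    have "(\<integral>\<^sup>+\<omega>. ennreal (norm (Q \<omega> * B (- u) \<omega>)) \<partial>M)
        \<le> (\<integral>\<^sup>+\<omega>. ennreal ((Q \<omega>)\<^sup>2) + ennreal ((B (- u) \<omega>)\<^sup>2) \<partial>M)"
      by (intro nn_integral_mono) (simp only: le ennreal_plus[symmetric] zero_le_power2 ennreal_leI)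
    also have "\<dots> = ennreal (expectation (\<lambda>\<omega>. (Q \<omega>)\<^sup>2)) + ennreal (expectation (\<lambda>\<omega>. (B (- u) \<omega>)\<^sup>2))"
      by (subst nn_integral_add) (auto simp: nn_integral_eq_integral Q integrable_B)
    finally show ?thesis by (simp add: variance_B)
  qed
  have "(\<integral>\<^sup>+p. ennreal (norm (Q (fst p) * B (- snd p) (fst p))) \<partial>(M \<Otimes>\<^sub>M exp_law l))
      = (\<integral>\<^sup>+u. (\<integral>\<^sup>+\<omega>. ennreal (norm (Q \<omega> * B (- u) \<omega>)) \<partial>M) \<partial>exp_law l)"
    using meas' by (subst P.nn_integral_snd[symmetric]) auto
  also have "\<dots> \<le> (\<integral>\<^sup>+u. ennreal (expectation (\<lambda>\<omega>. (Q \<omega>)\<^sup>2)) + ennreal (\<bar>u\<bar> powr (2 * H)) \<partial>exp_law l)"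
    by (intro nn_integral_mono inner)
  also have "\<dots> = ennreal (expectation (\<lambda>\<omega>. (Q \<omega>)\<^sup>2)) + ennreal (Gamma (2 * H + 1) / l powr (2 * H))"
    using exp_law_moment[of l "2 * H"] l_pos H_pos L.emeasure_space_1
    by (subst nn_integral_add) auto
  also have "\<dots> < \<infinity>" by simp
  finally show "(\<integral>\<^sup>+p. ennreal (norm (Q (fst p) * B (- snd p) (fst p))) \<partial>(M \<Otimes>\<^sub>M exp_law l)) < \<infinity>" .
qed

definition exp_average :: "'a \<Rightarrow> real" where
  "exp_average \<omega> = (LINT u|exp_law l. B (- u) \<omega>)"

lemma integrable_field: "integrable (M \<Otimes>\<^sub>M exp_law l) (\<lambda>p. B (- snd p) (fst p))"
  using integrable_weighted_field[of "\<lambda>_. 1"] by simp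

lemma AE_integrable_path: "AE \<omega> in M. integrable (exp_law l) (\<lambda>u. B (- u) \<omega>)"
  using P.AE_integrable_fst'[OF integrable_field] by simp

lemma measurable_exp_average [measurable]: "exp_average \<in> borel_measurable M"
  using borel_measurable_integrable[OF P.integrable_fst'[OF integrable_field]]
  by (simp add: exp_average_def[abs_def])

lemma expectation_mult_exp_average:
  assumes [measurable]: "Q \<in> borel_measurable M" and Q: "integrable M (\<lambda>\<omega>. (Q \<omega>)\<^sup>2)"
  shows "expectation (\<lambda>\<omega>. Q \<omega> * exp_average \<omega>) = (LINT u|exp_law l. expectation (\<lambda>\<omega>. Q \<omega> * B (- u) \<omega>))"
    and "integrable (exp_law l) (\<lambda>u. expectation (\<lambda>\<omega>. Q \<omega> * B (- u) \<omega>))"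
proof -
  note i = integrable_weighted_field[OF assms]
  have "expectation (\<lambda>\<omega>. Q \<omega> * exp_average \<omega>) = expectation (\<lambda>\<omega>. LINT u|exp_law l. Q \<omega> * B (- u) \<omega>)"
    by (simp add: exp_average_def)
  also have "\<dots> = (LINT u|exp_law l. expectation (\<lambda>\<omega>. Q \<omega> * B (- u) \<omega>))"
    using P.Fubini_integral[of "\<lambda>\<omega> u. Q \<omega> * B (- u) \<omega>"] i by (simp add: case_prod_beta')
  finally show "expectation (\<lambda>\<omega>. Q \<omega> * exp_average \<omega>) = (LINT u|exp_law l. expectation (\<lambda>\<omega>. Q \<omega> * B (- u) \<omega>))" .
  show "integrable (exp_law l) (\<lambda>u. expectation (\<lambda>\<omega>. Q \<omega> * B (- u) \<omega>))"
    using P.integrable_snd[of "\<lambda>\<omega> u. Q \<omega> * B (- u) \<omega>"] i by (simp add: case_prod_beta')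
qed

definition truncated_average :: "nat \<Rightarrow> 'a \<Rightarrow> real" where
  "truncated_average n \<omega> = (LINT u|exp_law l. indicator {0..real n} u * B (- u) \<omega>)"

lemma AE_exp_law_nonneg: "AE u in exp_law l. 0 \<le> u"
  by (subst AE_density) (auto simp: exponential_density_def)

lemma truncated_average_tendsto: "AE \<omega> in M. (\<lambda>n. truncated_average n \<omega>) \<longlonglongrightarrow> exp_average \<omega>"
  using AE_integrable_path
proof eventually_elim
  case (elim \<omega>)
  show ?case unfolding truncated_average_def exp_average_def
  proof (rule integral_dominated_convergence[where w = "\<lambda>u. \<bar>B (- u) \<omega>\<bar>"])
    show "integrable (exp_law l) (\<lambda>u. \<bar>B (- u) \<omega>\<bar>)" using elim by (rule integrable_abs)
    show "AE u in exp_law l. (\<lambda>n. indicator {0..real n} u * B (- u) \<omega>) \<longlonglongrightarrow> B (- u) \<omega>"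
      using AE_exp_law_nonneg
    proof eventually_elim
      case (elim u)
      obtain k where "u \<le> real k" using real_arch_simple by blast
      then have "\<forall>\<^sub>F n in sequentially. indicator {0..real n} u * B (- u) \<omega> = B (- u) \<omega>"
        using elim by (intro eventually_sequentiallyI[of k]) auto
      then show ?case by (rule tendsto_eventually)
    qed
  qed (auto simp: indicator_def)
qed

text \<open>On a bounded time interval the integral of a continuous path is the limit of its Riemann sums,
  which are linear combinations of values of \<open>B\<close> and hence Gaussian.\<close>

lemma truncated_average_gaussian: "centred_gaussian M (truncated_average n)"
proof (rule centred_gaussian_AE_limit)
  define q where "q k u = - (of_int \<lfloor>real (Suc k) * u\<rfloor> / real (Suc k))" for k and u :: real
  define J where "J k = (\<lambda>j. - (real j / real (Suc k))) ` {..n * Suc k}" for k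
  \<comment> \<open>The weight of \<open>B t\<close> in the Riemann sum is the exponential mass of the grid cell that starts at \<open>- t\<close>.\<close>
  define A where "A k t = {u \<in> {0..real n}. q k u = t}" for k t
  define R where "R k \<omega> = (\<Sum>t\<in>J k. measure (exp_law l) (A k t) * B t \<omega>)" for k \<omega>
  have q_meas [measurable]: "q k \<in> borel_measurable borel" for k
    unfolding q_def[abs_def] by measurable
  have A_meas: "A k t \<in> sets borel" for k t unfolding A_def by measurable
  have finJ: "finite (J k)" for k by (simp add: J_def)
  have q_bounds: "u - 1 / real (Suc k) \<le> - q k u" "- q k u \<le> u" "u \<ge> 0 \<Longrightarrow> 0 \<le> - q k u" for u k
  proof -
    have "real (Suc k) * u - 1 \<le> of_int \<lfloor>real (Suc k) * u\<rfloor>" by linarith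
    then have "(real (Suc k) * u - 1) / real (Suc k) \<le> - q k u"
      unfolding q_def minus_minus by (rule divide_right_mono) simp
    then show "u - 1 / real (Suc k) \<le> - q k u" by (simp add: diff_divide_distrib)
    have "of_int \<lfloor>real (Suc k) * u\<rfloor> / real (Suc k) \<le> (real (Suc k) * u) / real (Suc k)"
      by (rule divide_right_mono) (linarith, simp)
    then show "- q k u \<le> u" by (simp add: q_def)
    show "u \<ge> 0 \<Longrightarrow> 0 \<le> - q k u" by (simp add: q_def)
  qed
  have q_J: "q k u \<in> J k" if "u \<in> {0..real n}" for k u
  proof -
    have "real (Suc k) * u \<le> real (Suc k) * real n" using that by (intro mult_left_mono) auto
    then have "nat \<lfloor>real (Suc k) * u\<rfloor> \<le> n * Suc k"
      by (simp add: nat_le_iff floor_le_iff algebra_simps)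
    moreover have "q k u = - (real (nat \<lfloor>real (Suc k) * u\<rfloor>) / real (Suc k))"
      using that by (simp add: q_def)
    ultimately show ?thesis unfolding J_def by blast
  qed
  have R_eq: "R k \<omega> = (LINT u|exp_law l. indicator {0..real n} u * B (q k u) \<omega>)" for k \<omega>
  proof -
    have "R k \<omega> = (\<Sum>t\<in>J k. LINT u|exp_law l. indicator (A k t) u * B t \<omega>)"
      unfolding R_def using A_meas by (intro sum.cong) auto
    also have "\<dots> = (LINT u|exp_law l. (\<Sum>t\<in>J k. indicator (A k t) u * B t \<omega>))"
      using A_meas by (intro Bochner_Integration.integral_sum[symmetric] integrable_mult_left
         L.integrable_const_bound[where B = 1]) auto
    also have "\<dots> = (LINT u|exp_law l. indicator {0..real n} u * B (q k u) \<omega>)"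
    proof (intro Bochner_Integration.integral_cong refl)
      fix u
      have "indicator (A k t) u * B t \<omega> = (if t = q k u then indicator {0..real n} u * B t \<omega> else 0)" for t
        by (auto simp: A_def indicator_def)
      then show "(\<Sum>t\<in>J k. indicator (A k t) u * B t \<omega>) = indicator {0..real n} u * B (q k u) \<omega>"
        using q_J[of u k] finJ[of k] by (cases "u \<in> {0..real n}") (simp_all add: sum.delta)
    qed
    finally show ?thesis .
  qed
  show "centred_gaussian M (R k)" for k
  proof (rule gaussian_rv_imp_centred_gaussian)
    show "gaussian_rv M (R k)" unfolding R_def[abs_def] by (rule gaussian_combination[OF finJ])
    show "expectation (R k) = 0" unfolding R_def[abs_def]
      by (simp add: integrable_B expectation_B)
  qed
  show "AE \<omega> in M. (\<lambda>k. R k \<omega>) \<longlonglongrightarrow> truncated_average n \<omega>"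
  proof (rule AE_I2)
    fix \<omega>
    have "compact ((\<lambda>t. B t \<omega>) ` {- real n..0})"
      by (intro compact_continuous_image continuous_on_subset[OF paths]) auto
    then obtain C where C: "\<And>t. t \<in> {- real n..0} \<Longrightarrow> \<bar>B t \<omega>\<bar> \<le> C"
      by (fastforce dest: compact_imp_bounded simp: bounded_iff)
    show "(\<lambda>k. R k \<omega>) \<longlonglongrightarrow> truncated_average n \<omega>"
      unfolding R_eq truncated_average_def
    proof (rule integral_dominated_convergence[where w = "\<lambda>_. \<bar>C\<bar>"])
      show "AE u in exp_law l. norm (indicator {0..real n} u * B (q k u) \<omega>) \<le> \<bar>C\<bar>" for k
      proof (rule AE_I2)
        fix u
        show "norm (indicator {0..real n} u * B (q k u) \<omega>) \<le> \<bar>C\<bar>"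
          using C[of "q k u"] q_bounds(2)[of k u] q_bounds(3)[of u k] by (cases "u \<in> {0..real n}") auto
      qed
      show "AE u in exp_law l. (\<lambda>k. indicator {0..real n} u * B (q k u) \<omega>)
          \<longlonglongrightarrow> indicator {0..real n} u * B (- u) \<omega>"
      proof (rule AE_I2)
        fix u
        have "(\<lambda>k. - q k u) \<longlonglongrightarrow> u"
        proof (rule tendsto_sandwich[OF _ _ _ tendsto_const])
          have "(\<lambda>k. u - 1 / real (Suc k)) \<longlonglongrightarrow> u - 0"
            by (intro tendsto_diff tendsto_const LIMSEQ_Suc[OF lim_1_over_n])
          then show "(\<lambda>k. u - 1 / real (Suc k)) \<longlonglongrightarrow> u" by simp
        qed (use q_bounds in auto)
        then have "(\<lambda>k. q k u) \<longlonglongrightarrow> - u" using tendsto_minus by fastforce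
        moreover have "isCont (\<lambda>t. B t \<omega>) (- u)"
          using paths by (simp add: continuous_on_eq_continuous_at)
        ultimately show "(\<lambda>k. indicator {0..real n} u * B (q k u) \<omega>) \<longlonglongrightarrow> indicator {0..real n} u * B (- u) \<omega>"
          by (intro tendsto_mult tendsto_const isCont_tendsto_compose[where g = "\<lambda>t. B t \<omega>"])
      qed
      have "(\<lambda>u. B (q k u) \<omega>) \<in> borel_measurable borel" for k
        using measurable_compose[OF _ measurable_path, of "\<lambda>u. - q k u"] by simp
      then show "(\<lambda>u. indicator {0..real n} u * B (q k u) \<omega>) \<in> borel_measurable (exp_law l)" for k
        by simp
    qed auto
  qed
  have "integrable (M \<Otimes>\<^sub>M exp_law l) (\<lambda>p. indicator {0..real n} (snd p) * B (- snd p) (fst p))"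
  proof (rule Bochner_Integration.integrable_bound[OF integrable_field])
    have "(\<lambda>p. indicator {0..real n} (snd p) * B (- snd p) (fst p)) \<in> borel_measurable (M \<Otimes>\<^sub>M borel)"
      by measurable
    then show "(\<lambda>p. indicator {0..real n} (snd p) * B (- snd p) (fst p)) \<in> borel_measurable (M \<Otimes>\<^sub>M exp_law l)"
      by (subst measurable_cong_sets[OF sets_pair_measure_cong refl]) auto
  qed (auto simp: indicator_def)
  from borel_measurable_integrable[OF P.integrable_fst'[OF this]]
  show "truncated_average n \<in> borel_measurable M"
    by (simp add: truncated_average_def[abs_def])
qed

text \<open>Paths need not be bounded over the whole past, so Riemann sums are applied to the truncated averages
  only, and a second limit removes the truncation.\<close>

lemma exp_average_gaussian: "centred_gaussian M exp_average"
  by (rule centred_gaussian_AE_limit[OF truncated_average_gaussian measurable_exp_average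
        truncated_average_tendsto])

text \<open>The square of the average is expanded one factor at a time, so that the average is paired with
  \<open>B (- v)\<close> first and \<open>B (- v)\<close> with \<open>B (- u)\<close> next; both exchanges of integrals are instances of
  \<open>expectation_mult_exp_average\<close>. What remains is the exponential mean of the covariance function, whose
  three powers all have the same mean \<open>g\<close>.\<close>

lemma variance_exp_average:
  "expectation (\<lambda>\<omega>. (exp_average \<omega>)\<^sup>2) = Gamma (2 * H + 1) / (2 * l powr (2 * H))"
proof -
  define p where "p = 2 * H"
  have p: "p > 0" using H_pos by (simp add: p_def)
  define g where "g = Gamma (p + 1) / l powr p"
  have g: "g \<ge> 0" using p by (simp add: g_def Gamma_real_nonneg)
  have moment: "integrable (exp_law l) (\<lambda>u. \<bar>u\<bar> powr p)" "(LINT u|exp_law l. \<bar>u\<bar> powr p) = g"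
    using exp_law_moment[OF l_pos p] g
    by (auto simp: g_def integral_eq_nn_integral intro!: integrableI_bounded)
  have cov: "expectation (\<lambda>\<omega>. B (- v) \<omega> * B (- u) \<omega>) = (\<bar>v\<bar> powr p + \<bar>u\<bar> powr p - \<bar>u - v\<bar> powr p) / 2" for u v
    using covariance_B[of "- v" "- u"] by (simp add: p_def abs_minus_commute)
  define d where "d v = (LINT u|exp_law l. \<bar>u - v\<bar> powr p)" for v
  \<comment> \<open>The increment term is handled as a combination of the covariance and the two pure powers, so that
    its integrability is inherited from theirs.\<close>
  have i1: "integrable (exp_law l) (\<lambda>u. \<bar>u - v\<bar> powr p)" for v
  proof -
    have "integrable (exp_law l) (\<lambda>u. \<bar>v\<bar> powr p + \<bar>u\<bar> powr p - 2 * expectation (\<lambda>\<omega>. B (- v) \<omega> * B (- u) \<omega>))"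
      using expectation_mult_exp_average(2)[OF measurable_B[of "- v"] integrable_B(2)] moment by auto
    then show ?thesis by (simp add: cov add_divide_distrib diff_divide_distrib)
  qed
  have E1: "expectation (\<lambda>\<omega>. B (- v) \<omega> * exp_average \<omega>) = (\<bar>v\<bar> powr p + g - d v) / 2" for v
  proof -
    have "expectation (\<lambda>\<omega>. B (- v) \<omega> * exp_average \<omega>) = (LINT u|exp_law l. (\<bar>v\<bar> powr p + \<bar>u\<bar> powr p - \<bar>u - v\<bar> powr p) / 2)"
      using expectation_mult_exp_average(1)[OF measurable_B[of "- v"] integrable_B(2)] by (simp add: cov)
    also have "\<dots> = (\<bar>v\<bar> powr p + g - d v) / 2"
      using i1[of v] moment L.prob_space by (simp add: d_def)
    finally show ?thesis .
  qed
  note W2 = centred_gaussian_moments(1)[OF exp_average_gaussian]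
  have i2: "integrable (exp_law l) d"
  proof -
    have "integrable (exp_law l) (\<lambda>v. \<bar>v\<bar> powr p + g - 2 * expectation (\<lambda>\<omega>. exp_average \<omega> * B (- v) \<omega>))"
      using expectation_mult_exp_average(2)[OF measurable_exp_average W2] moment by auto
    then show ?thesis by (simp add: E1 mult.commute[of "exp_average _"] add_divide_distrib diff_divide_distrib)
  qed
  have d_int: "(LINT v|exp_law l. d v) = g"
  proof -
    have "ennreal (LINT v|exp_law l. d v) = (\<integral>\<^sup>+v. ennreal (d v) \<partial>exp_law l)"
      by (rule nn_integral_eq_integral[symmetric, OF i2]) (simp add: d_def)
    also have "\<dots> = (\<integral>\<^sup>+v. (\<integral>\<^sup>+u. ennreal (\<bar>u - v\<bar> powr p) \<partial>exp_law l) \<partial>exp_law l)"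
      by (simp add: d_def nn_integral_eq_integral i1)
    also have "\<dots> = ennreal g" using exp_law_difference_moment[OF l_pos p] by (simp add: g_def)
    finally show ?thesis using g by (simp add: d_def)
  qed
  have "expectation (\<lambda>\<omega>. (exp_average \<omega>)\<^sup>2) = (LINT v|exp_law l. expectation (\<lambda>\<omega>. exp_average \<omega> * B (- v) \<omega>))"
    using expectation_mult_exp_average(1)[OF measurable_exp_average W2] by (simp add: power2_eq_square)
  also have "\<dots> = (LINT v|exp_law l. (\<bar>v\<bar> powr p + g - d v) / 2)"
    by (simp add: E1 mult.commute[of "exp_average _"])
  also have "\<dots> = g / 2"
    using i2 moment d_int L.prob_space by simp
  finally show ?thesis by (simp add: g_def p_def)
qed

end

section \<open>The marginal law of the stationary solution\<close>

lemma fractional_brownian_motion_measurable: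
  assumes "fractional_brownian_motion M H B"
  shows "B t \<in> borel_measurable M"
proof -
  have "gaussian_process M B" using assms by (simp add: fractional_brownian_motion_def)
  from this[unfolded gaussian_process_def, rule_format, of "{t}" "\<lambda>_. 1"] show ?thesis
    by (simp add: gaussian_rv_def)
qed

lemma fractional_brownian_motion_modification:
  fixes B B' :: "real \<Rightarrow> 'a \<Rightarrow> real"
  assumes fbm: "fractional_brownian_motion M H B"
    and meas [measurable]: "\<And>t. B' t \<in> borel_measurable M"
    and cont: "\<And>\<omega>. continuous_on UNIV (\<lambda>t. B' t \<omega>)"
    and ae: "AE \<omega> in M. \<forall>t. B' t \<omega> = B t \<omega>"
  shows "fractional_brownian_motion M H B'"
proof -
  have meas' [measurable]: "B t \<in> borel_measurable M" for t
    by (rule fractional_brownian_motion_measurable[OF fbm])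
  have "gaussian_rv M (\<lambda>\<omega>. \<Sum>t\<in>J. a t * B' t \<omega>)" if "finite J" for J a
  proof -
    have "distr M borel (\<lambda>\<omega>. \<Sum>t\<in>J. a t * B' t \<omega>) = distr M borel (\<lambda>\<omega>. \<Sum>t\<in>J. a t * B t \<omega>)"
      by (intro distr_cong_AE AE_mp[OF ae AE_I2]) auto
    moreover have "gaussian_rv M (\<lambda>\<omega>. \<Sum>t\<in>J. a t * B t \<omega>)"
      using fbm that by (simp add: fractional_brownian_motion_def gaussian_process_def)
    ultimately show ?thesis using meas by (simp add: gaussian_rv_def)
  qed
  moreover have "(LINT \<omega>|M. B' t \<omega>) = (LINT \<omega>|M. B t \<omega>)" for t
    by (intro integral_cong_AE AE_mp[OF ae AE_I2]) auto
  moreover have "(LINT \<omega>|M. B' s \<omega> * B' t \<omega>) = (LINT \<omega>|M. B s \<omega> * B t \<omega>)" for s t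
    by (intro integral_cong_AE AE_mp[OF ae AE_I2]) auto
  ultimately show ?thesis
    using fbm cont by (auto simp: fractional_brownian_motion_def gaussian_process_def)
qed

lemma strictly_stationary_marginals:
  assumes st: "strictly_stationary M Y"
  shows "distr M borel (Y t) = distr M borel (Y s)"
proof -
  have meas [measurable]: "Y t \<in> borel_measurable M" for t using st by (simp add: strictly_stationary_def)
  have eq: "distr M borel (Y (0 + h)) = distr M borel (Y 0)" for h
  proof -
    let ?P = "\<Pi>\<^sub>M t\<in>{0::real}. (borel :: real measure)"
    have "distr M ?P (\<lambda>\<omega>. \<lambda>t\<in>{0}. Y (t + h) \<omega>) = distr M ?P (\<lambda>\<omega>. \<lambda>t\<in>{0}. Y t \<omega>)"
      using st by (simp add: strictly_stationary_def)
    then have "distr (distr M ?P (\<lambda>\<omega>. \<lambda>t\<in>{0}. Y (t + h) \<omega>)) borel (\<lambda>f. f 0)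
        = distr (distr M ?P (\<lambda>\<omega>. \<lambda>t\<in>{0}. Y t \<omega>)) borel (\<lambda>f. f 0)"
      by simp
    moreover have "(\<lambda>f. f 0) \<in> measurable ?P borel" by (rule measurable_component_singleton) simp
    moreover have "(\<lambda>\<omega>. \<lambda>t\<in>{0}. Y (t + h) \<omega>) \<in> measurable M ?P" for h
      by (rule measurable_restrict) simp
    moreover from this[of 0] have "(\<lambda>\<omega>. \<lambda>t\<in>{0}. Y t \<omega>) \<in> measurable M ?P" by simp
    ultimately show ?thesis by (simp add: distr_distr comp_def)
  qed
  from eq[of t] eq[of s] show ?thesis by simp
qed

text \<open>Truncation at one metrises convergence in probability. It is the right notion of smallness here
  because no moments of the stationary solution are known beforehand.\<close>

lemma (in prob_space) AE_eq_0_if_truncated_bound: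
  fixes D :: "'a \<Rightarrow> real" and e :: "nat \<Rightarrow> real"
  assumes [measurable]: "D \<in> borel_measurable M"
    and le: "\<And>n. expectation (\<lambda>\<omega>. min 1 \<bar>D \<omega>\<bar>) \<le> e n" and e: "e \<longlonglongrightarrow> 0"
  shows "AE \<omega> in M. D \<omega> = 0"
proof -
  have i: "integrable M (\<lambda>\<omega>. min 1 \<bar>D \<omega>\<bar>)"
    by (rule integrable_const_bound[where B = 1]) auto
  have "expectation (\<lambda>\<omega>. min 1 \<bar>D \<omega>\<bar>) \<le> 0"
    by (rule LIMSEQ_le_const[OF e]) (use le in auto)
  moreover have "0 \<le> expectation (\<lambda>\<omega>. min 1 \<bar>D \<omega>\<bar>)" by simp
  ultimately have "expectation (\<lambda>\<omega>. min 1 \<bar>D \<omega>\<bar>) = 0" by simp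
  then have "AE \<omega> in M. min 1 \<bar>D \<omega>\<bar> = 0"
    using integral_nonneg_eq_0_iff_AE[OF i] by simp
  then show ?thesis by eventually_elim (auto simp: min_def split: if_splits)
qed

lemma (in prob_space) truncated_expectation_tendsto_0:
  fixes D :: "nat \<Rightarrow> 'a \<Rightarrow> real"
  assumes [measurable]: "\<And>n. D n \<in> borel_measurable M"
    and lim: "AE \<omega> in M. (\<lambda>n. D n \<omega>) \<longlonglongrightarrow> 0"
  shows "(\<lambda>n. expectation (\<lambda>\<omega>. min 1 \<bar>D n \<omega>\<bar>)) \<longlonglongrightarrow> 0"
proof -
  have "(\<lambda>n. expectation (\<lambda>\<omega>. min 1 \<bar>D n \<omega>\<bar>)) \<longlonglongrightarrow> expectation (\<lambda>\<omega>. 0)"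
  proof (rule integral_dominated_convergence[where w = "\<lambda>_. 1"])
    show "AE \<omega> in M. (\<lambda>n. min 1 \<bar>D n \<omega>\<bar>) \<longlonglongrightarrow> 0"
      using lim
    proof eventually_elim
      case (elim \<omega>)
      then have "(\<lambda>n. min 1 \<bar>D n \<omega>\<bar>) \<longlonglongrightarrow> min 1 \<bar>0\<bar>" by (intro tendsto_intros)
      then show ?case by simp
    qed
  qed auto
  then show ?thesis by simp
qed

text \<open>By the variation of constants formula the sum of \<open>Y 0\<close> and \<open>c\<close> times the average differs from zero by three errors: the damped
  value of \<open>Y\<close> at time \<open>- n\<close>, which has the law of the damped \<open>Y 0\<close>; the damped value of \<open>B\<close>,
  whose variance grows only polynomially; and the truncation of the average. All three tend to zero
  in probability.\<close>

lemma (in continuous_fbm) stationary_solution_eq_exp_average: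
  fixes Y :: "real \<Rightarrow> 'a \<Rightarrow> real"
  assumes st: "strictly_stationary M Y"
    and sol: "AE \<omega> in M. continuous_on UNIV (\<lambda>t. Y t \<omega>) \<and>
        (\<forall>s t. s \<le> t \<longrightarrow> Y t \<omega> - Y s \<omega> = - l * (LBINT r:{s..t}. Y r \<omega>) + c * (B t \<omega> - B s \<omega>))"
  shows "AE \<omega> in M. Y 0 \<omega> + c * exp_average \<omega> = 0"
proof -
  have [measurable]: "Y t \<in> borel_measurable M" for t using st by (simp add: strictly_stationary_def)
  have [measurable]: "truncated_average n \<in> borel_measurable M" for n
    using truncated_average_gaussian by (simp add: centred_gaussian_def)
  have pathwise: "AE \<omega> in M. \<forall>n. Y 0 \<omega> + c * truncated_average n \<omega>
      = exp (- l * real n) * Y (- real n) \<omega> - exp (- l * real n) * c * B (- real n) \<omega>"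
    using sol B_zero
  proof eventually_elim
    case (elim \<omega>)
    show ?case
    proof
      fix n
      have "Y 0 \<omega> - c * B 0 \<omega> = exp (- l * real n) * (Y (- real n) \<omega> - c * B (- real n) \<omega>)
         - c * (LINT u|exp_law l. indicator {0..real n} u * B (- u) \<omega>)"
        by (rule ou_variation_of_constants) (use elim paths l_pos in auto)
      then show "Y 0 \<omega> + c * truncated_average n \<omega>
        = exp (- l * real n) * Y (- real n) \<omega> - exp (- l * real n) * c * B (- real n) \<omega>"
        using elim by (simp add: truncated_average_def algebra_simps)
    qed
  qed
  define h where "h x = min 1 \<bar>x\<bar>" for x :: real
  have h_int: "integrable M (\<lambda>\<omega>. h (f \<omega>))" if [measurable]: "f \<in> borel_measurable M" for f
    unfolding h_def by (rule integrable_const_bound[where B = 1]) auto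
  have h_add: "h x \<le> h a + h b + h d" if "x = a - b + d" for x a b d
    using that unfolding h_def by linarith
  define e1 where "e1 n = expectation (\<lambda>\<omega>. h (exp (- l * real n) * Y 0 \<omega>))" for n
  define e2 where "e2 n = exp (- l * real n) * \<bar>c\<bar> * (1 + real n powr (2 * H))" for n
  define e3 where "e3 n = expectation (\<lambda>\<omega>. h (c * (exp_average \<omega> - truncated_average n \<omega>)))" for n
  have decay: "(\<lambda>n. exp (- l * real n)) \<longlonglongrightarrow> 0"
    using l_pos by (intro filterlim_compose[OF exp_at_bot]
        filterlim_tendsto_neg_mult_at_bot[OF tendsto_const _ filterlim_real_sequentially]) auto
  have e1: "e1 \<longlonglongrightarrow> 0" unfolding e1_def h_def
  proof (rule truncated_expectation_tendsto_0)
    show "AE \<omega> in M. (\<lambda>n. exp (- l * real n) * Y 0 \<omega>) \<longlonglongrightarrow> 0"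
      by (intro AE_I2 tendsto_mult_left_zero decay)
  qed auto
  have e2: "e2 \<longlonglongrightarrow> 0" unfolding e2_def using l_pos H_pos by real_asymp
  have e3: "e3 \<longlonglongrightarrow> 0" unfolding e3_def h_def
  proof (rule truncated_expectation_tendsto_0)
    show "AE \<omega> in M. (\<lambda>n. c * (exp_average \<omega> - truncated_average n \<omega>)) \<longlonglongrightarrow> 0"
      using truncated_average_tendsto
    proof eventually_elim
      case (elim \<omega>)
      then have "(\<lambda>n. c * (exp_average \<omega> - truncated_average n \<omega>)) \<longlonglongrightarrow> c * (exp_average \<omega> - exp_average \<omega>)"
        by (intro tendsto_intros)
      then show ?case by simp
    qed
  qed auto
  have b1: "expectation (\<lambda>\<omega>. h (exp (- l * real n) * Y (- real n) \<omega>)) = e1 n" for n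
  proof -
    have "expectation (\<lambda>\<omega>. h (exp (- l * real n) * Y t \<omega>)) = (LINT x|distr M borel (Y t). h (exp (- l * real n) * x))" for t
      unfolding h_def by (subst integral_distr) auto
    then show ?thesis using strictly_stationary_marginals[OF st, of "- real n" 0] by (simp add: e1_def)
  qed
  have b2: "expectation (\<lambda>\<omega>. h (exp (- l * real n) * c * B (- real n) \<omega>)) \<le> e2 n" for n
  proof -
    have "expectation (\<lambda>\<omega>. h (exp (- l * real n) * c * B (- real n) \<omega>))
        \<le> expectation (\<lambda>\<omega>. exp (- l * real n) * \<bar>c\<bar> * (1 + (B (- real n) \<omega>)\<^sup>2))"
    proof (rule integral_mono[OF h_int])
      fix \<omega>
      have "\<bar>x\<bar> \<le> 1 + x\<^sup>2" for x :: real
      proof -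
        have "0 \<le> (\<bar>x\<bar> - 1)\<^sup>2" by simp
        then have "2 * \<bar>x\<bar> \<le> 1 + x\<^sup>2" by (simp add: power2_diff)
        then show ?thesis by linarith
      qed
      then have "exp (- l * real n) * \<bar>c\<bar> * \<bar>B (- real n) \<omega>\<bar> \<le> exp (- l * real n) * \<bar>c\<bar> * (1 + (B (- real n) \<omega>)\<^sup>2)"
        by (intro mult_left_mono) auto
      then show "h (exp (- l * real n) * c * B (- real n) \<omega>) \<le> exp (- l * real n) * \<bar>c\<bar> * (1 + (B (- real n) \<omega>)\<^sup>2)"
        unfolding h_def abs_mult abs_exp_cancel by (rule min.coboundedI2)
    qed (auto simp: integrable_B)
    also have "\<dots> = e2 n"
      by (simp add: e2_def integrable_B prob_space variance_B)
    finally show ?thesis .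
  qed
  have bound: "expectation (\<lambda>\<omega>. h (Y 0 \<omega> + c * exp_average \<omega>)) \<le> e1 n + e2 n + e3 n" for n
  proof -
    have "expectation (\<lambda>\<omega>. h (Y 0 \<omega> + c * exp_average \<omega>)) \<le>
      expectation (\<lambda>\<omega>. h (exp (- l * real n) * Y (- real n) \<omega>) + h (exp (- l * real n) * c * B (- real n) \<omega>)
        + h (c * (exp_average \<omega> - truncated_average n \<omega>)))"
    proof (rule integral_mono_AE)
      show "AE \<omega> in M. h (Y 0 \<omega> + c * exp_average \<omega>) \<le>
        h (exp (- l * real n) * Y (- real n) \<omega>) + h (exp (- l * real n) * c * B (- real n) \<omega>)
        + h (c * (exp_average \<omega> - truncated_average n \<omega>))"
        using pathwise
      proof eventually_elim
        case (elim \<omega>)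
        from elim[rule_format, of n] show ?case by (intro h_add) (simp add: algebra_simps)
      qed
    qed (intro Bochner_Integration.integrable_add h_int; simp)+
    also have "\<dots> = e1 n + expectation (\<lambda>\<omega>. h (exp (- l * real n) * c * B (- real n) \<omega>)) + e3 n"
      by (simp add: h_int b1[symmetric] e3_def)
    finally show ?thesis using b2[of n] by linarith
  qed
  show ?thesis
  proof (rule AE_eq_0_if_truncated_bound)
    show "(\<lambda>n. e1 n + e2 n + e3 n) \<longlonglongrightarrow> 0" using tendsto_add[OF tendsto_add[OF e1 e2] e3] by simp
    show "expectation (\<lambda>\<omega>. min 1 \<bar>Y 0 \<omega> + c * exp_average \<omega>\<bar>) \<le> e1 n + e2 n + e3 n" for n
      using bound[of n] by (simp add: h_def)
  qed auto
qed

text \<open>The average has variance \<open>1 / c\<^sup>2\<close>, which is what the constant \<open>fou_sigma\<close> is made for. The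
  powers of \<open>\<epsilon>\<close> cancel by the self-similarity of the noise.\<close>

lemma stationary_fou_marginal:
  fixes M :: "'a measure" and B Y :: "real \<Rightarrow> 'a \<Rightarrow> real"
  assumes M: "prob_space M" and H: "0 < H" and fbm: "fractional_brownian_motion M H B"
    and \<epsilon>: "\<epsilon> > 0" and sol: "stationary_fou_solution M H B \<epsilon> Y"
  shows "distr M borel (Y t) = std_normal_distribution"
proof -
  interpret prob_space M by (rule M)
  interpret N: prob_space std_normal_distribution by (rule prob_space_normal_density) simp
  have st: "strictly_stationary M Y" using sol by (simp add: stationary_fou_solution_def)
  then have [measurable]: "Y t \<in> borel_measurable M" for t by (simp add: strictly_stationary_def)
  note measB = fractional_brownian_motion_measurable[OF fbm]
  have contB: "AE \<omega> in M. continuous_on UNIV (\<lambda>t. B t \<omega>)"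
    using fbm by (simp add: fractional_brownian_motion_def)
  from continuous_modification[OF measB contB]
  obtain B' where "(\<forall>t. B' t \<in> borel_measurable M) \<and> (\<forall>\<omega>. continuous_on UNIV (\<lambda>t. B' t \<omega>)) \<and>
    (AE \<omega> in M. \<forall>t. B' t \<omega> = B t \<omega>)" ..
  then have B': "\<And>t. B' t \<in> borel_measurable M" "\<And>\<omega>. continuous_on UNIV (\<lambda>t. B' t \<omega>)"
    "AE \<omega> in M. \<forall>t. B' t \<omega> = B t \<omega>" by simp_all
  define l where "l = 1 / \<epsilon>"
  define c where "c = fou_sigma H / \<epsilon> powr H"
  have l: "l > 0" using \<epsilon> by (simp add: l_def)
  interpret continuous_fbm M H B' l
    by (intro continuous_fbm.intro continuous_fbm_axioms.intro M H l B'(2)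
        fractional_brownian_motion_modification[OF fbm B'])
  have "AE \<omega> in M. Y 0 \<omega> + c * exp_average \<omega> = 0"
  proof (rule stationary_solution_eq_exp_average[OF st])
    have "AE \<omega> in M. continuous_on UNIV (\<lambda>t. Y t \<omega>) \<and> (\<forall>s t. s \<le> t \<longrightarrow>
           Y t \<omega> - Y s \<omega> = - (1 / \<epsilon>) * (LBINT r:{s..t}. Y r \<omega>)
             + fou_sigma H / \<epsilon> powr H * (B t \<omega> - B s \<omega>))"
      using sol by (simp add: stationary_fou_solution_def)
    then show "AE \<omega> in M. continuous_on UNIV (\<lambda>t. Y t \<omega>) \<and> (\<forall>s t. s \<le> t \<longrightarrow>
           Y t \<omega> - Y s \<omega> = - l * (LBINT r:{s..t}. Y r \<omega>) + c * (B' t \<omega> - B' s \<omega>))"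
      using B'(3) by eventually_elim (simp add: l_def c_def)
  qed
  then have "AE \<omega> in M. Y 0 \<omega> = - c * exp_average \<omega>" by eventually_elim simp
  then have "distr M borel (Y 0) = distr M borel (\<lambda>\<omega>. - c * exp_average \<omega>)"
    by (intro distr_cong_AE) auto
  also have "\<dots> = distr (distr M borel exp_average) borel (\<lambda>x. - c * x)"
    by (simp add: distr_distr comp_def)
  also have "\<dots> = distr std_normal_distribution borel (\<lambda>x. (- c * sqrt (expectation (\<lambda>\<omega>. (exp_average \<omega>)\<^sup>2))) * x)"
    by (subst centred_gaussian_moments(2)[OF exp_average_gaussian]) (auto simp: distr_distr comp_def mult.assoc intro!: distr_cong)
  finally have d: "distr M borel (Y 0) = distr std_normal_distribution borel
    (\<lambda>x. (- c * sqrt (expectation (\<lambda>\<omega>. (exp_average \<omega>)\<^sup>2))) * x)" .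
  have G: "Gamma (2 * H + 1) > 0" using H by (simp add: Gamma_real_pos)
  have "(c * sqrt (expectation (\<lambda>\<omega>. (exp_average \<omega>)\<^sup>2)))\<^sup>2 = c\<^sup>2 * (Gamma (2 * H + 1) / (2 * l powr (2 * H)))"
    using G by (simp add: power_mult_distrib variance_exp_average)
  also have "c\<^sup>2 = (2 / Gamma (2 * H + 1)) * l powr (2 * H)"
    using G \<epsilon> by (simp add: c_def l_def fou_sigma_def power_divide powr_divide powr_power mult.commute)
  also have "(2 / Gamma (2 * H + 1)) * l powr (2 * H) * (Gamma (2 * H + 1) / (2 * l powr (2 * H))) = 1"
    using G l by simp
  finally have 1: "(c * sqrt (expectation (\<lambda>\<omega>. (exp_average \<omega>)\<^sup>2)))\<^sup>2 = 1" .
  \<comment> \<open>The minus sign in front of \<open>c\<close> is harmless since the normal law is symmetric.\<close>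
  define k where "k = - c * sqrt (expectation (\<lambda>\<omega>. (exp_average \<omega>)\<^sup>2))"
  have "k\<^sup>2 = 1" unfolding k_def mult_minus_left power2_minus by (rule 1)
  then have "char (distr M borel (Y 0)) = char std_normal_distribution"
    unfolding d k_def[symmetric]
    by (simp add: fun_eq_iff char_std_normal_scaled char_std_normal_distribution power_mult_distrib)
  then have "distr M borel (Y 0) = std_normal_distribution"
    by (intro Levy_uniqueness real_distribution_distr real_dist_normal_dist) simp_all
  then show ?thesis using strictly_stationary_marginals[OF st, of t 0] by simp
qed

section \<open>Second moments of the slow increments\<close>

text \<open>Finiteness of the energy on all of \<open>[0, b]\<close> is required, not only on \<open>[a, b]\<close>: otherwise one of
  the two integrals could be the default value zero, and their difference would not be the integral
  over the increment.\<close>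

lemma squared_integral_increment_le:
  fixes g :: "real \<Rightarrow> real"
  assumes [measurable]: "g \<in> borel_measurable borel"
    and ab: "0 \<le> a" "a \<le> b"
    and fin: "(\<integral>\<^sup>+s. ennreal ((g s)\<^sup>2) * indicator {0..b} s \<partial>lborel) < \<infinity>"
  shows "ennreal (((LBINT s:{0..b}. g s) - (LBINT s:{0..a}. g s))\<^sup>2)
    \<le> ennreal (b - a) * (\<integral>\<^sup>+s. ennreal ((g s)\<^sup>2) * indicator {a..b} s \<partial>lborel)"
proof -
  have int: "set_integrable lborel {0..b} g"
    unfolding set_integrable_def
  proof (rule integrableI_bounded)
    have "(\<integral>\<^sup>+s. ennreal (norm (indicator {0..b} s *\<^sub>R g s)) \<partial>lborel)
        \<le> (\<integral>\<^sup>+s. indicator {0..b} s + ennreal ((g s)\<^sup>2) * indicator {0..b} s \<partial>lborel)"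
    proof (rule nn_integral_mono)
      fix s
      have "0 \<le> (\<bar>g s\<bar> - 1)\<^sup>2" by simp
      then have "2 * \<bar>g s\<bar> \<le> 1 + (g s)\<^sup>2" by (simp add: power2_diff)
      then have "\<bar>g s\<bar> \<le> 1 + (g s)\<^sup>2" by linarith
      then have "ennreal \<bar>g s\<bar> \<le> ennreal (1 + (g s)\<^sup>2)" by (rule ennreal_leI)
      then show "ennreal (norm (indicator {0..b} s *\<^sub>R g s)) \<le> indicator {0..b} s + ennreal ((g s)\<^sup>2) * indicator {0..b} s"
        by (simp split: split_indicator)
    qed
    also have "\<dots> = ennreal b + (\<integral>\<^sup>+s. ennreal ((g s)\<^sup>2) * indicator {0..b} s \<partial>lborel)"
      using ab by (subst nn_integral_add) auto
    also have "\<dots> < \<infinity>" using fin by (simp add: ennreal_add_eq_top less_top)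
    finally show "(\<integral>\<^sup>+s. ennreal (norm (indicator {0..b} s *\<^sub>R g s)) \<partial>lborel) < \<infinity>" .
  qed simp
  have "(LBINT s:{0..b}. g s) = (LBINT s:{0..a} \<union> {a<..b}. g s)"
    using ab by (intro arg_cong[where f = "\<lambda>A. LBINT s:A. g s"]) auto
  also have "\<dots> = (LBINT s:{0..a}. g s) + (LBINT s:{a<..b}. g s)"
    using ab by (intro set_integral_Un set_integrable_subset[OF int]) auto
  finally have diff: "(LBINT s:{0..b}. g s) - (LBINT s:{0..a}. g s) = (LBINT s:{a<..b}. g s)" by simp
  let ?i = "\<lambda>s. indicator {a<..b} s :: ennreal"
  have "ennreal \<bar>LBINT s:{a<..b}. g s\<bar> \<le> (\<integral>\<^sup>+s. ?i s * (ennreal \<bar>g s\<bar> * ?i s) \<partial>lborel)"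
  proof -
    have "set_integrable lborel {a<..b} g" using ab by (intro set_integrable_subset[OF int]) auto
    from integral_norm_bound_ennreal[OF this[unfolded set_integrable_def]]
    have "ennreal \<bar>LBINT s:{a<..b}. g s\<bar> \<le> (\<integral>\<^sup>+s. ennreal (norm (indicator {a<..b} s *\<^sub>R g s)) \<partial>lborel)"
      by (simp add: set_lebesgue_integral_def)
    also have "\<dots> = (\<integral>\<^sup>+s. ?i s * (ennreal \<bar>g s\<bar> * ?i s) \<partial>lborel)"
      by (intro nn_integral_cong) (simp split: split_indicator)
    finally show ?thesis .
  qed
  then have "ennreal \<bar>LBINT s:{a<..b}. g s\<bar> ^ 2 \<le> (\<integral>\<^sup>+s. ?i s * (ennreal \<bar>g s\<bar> * ?i s) \<partial>lborel)\<^sup>2"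
    by (intro power_mono) auto
  also have "\<dots> \<le> (\<integral>\<^sup>+s. (?i s)\<^sup>2 \<partial>lborel) * (\<integral>\<^sup>+s. (ennreal \<bar>g s\<bar> * ?i s)\<^sup>2 \<partial>lborel)"
    by (rule Cauchy_Schwarz_nn_integral) auto
  also have "(\<integral>\<^sup>+s. (?i s)\<^sup>2 \<partial>lborel) = (\<integral>\<^sup>+s. ?i s \<partial>lborel)"
    by (intro nn_integral_cong) (simp split: split_indicator)
  also have "\<dots> = ennreal (b - a)" using ab by simp
  also have "(\<integral>\<^sup>+s. (ennreal \<bar>g s\<bar> * ?i s)\<^sup>2 \<partial>lborel) \<le> (\<integral>\<^sup>+s. ennreal ((g s)\<^sup>2) * indicator {a..b} s \<partial>lborel)"
    by (intro nn_integral_mono) (simp add: ennreal_power split: split_indicator)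
  finally show ?thesis
    by (simp add: diff ennreal_power mult_left_mono)
qed

text \<open>The common standard normal law makes the expected energy of \<open>G (Y s)\<close> proportional to the length of the time
  interval. Its finiteness also shows that almost surely the integrals defining \<open>X\<close> exist.\<close>

lemma slow_increment_second_moment:
  fixes Y X :: "real \<Rightarrow> 'a \<Rightarrow> real"
  assumes M: "prob_space M"
    and law: "\<And>t. distr M borel (Y t) = std_normal_distribution"
    and meas: "\<And>t. Y t \<in> borel_measurable M"
    and cont: "AE \<omega> in M. continuous_on UNIV (\<lambda>t. Y t \<omega>)"
    and G: "in_L2_gauss G" and sol: "slow_solution M \<alpha> G Y X"
    and ab: "0 \<le> a" "a \<le> b"
  shows "(\<integral>\<^sup>+\<omega>. ennreal ((X b \<omega> - X a \<omega>)\<^sup>2) \<partial>M)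
    \<le> ennreal (\<alpha>\<^sup>2 * (b - a)\<^sup>2 * (LINT x|std_normal_distribution. (G x)\<^sup>2))"
proof -
  interpret prob_space M by (rule M)
  interpret PL: pair_sigma_finite M lborel ..
  define K where "K = (LINT x|std_normal_distribution. (G x)\<^sup>2)"
  have K: "K \<ge> 0" by (simp add: K_def)
  have [measurable]: "G \<in> borel_measurable borel" using G by (simp add: in_L2_gauss_def)
  from continuous_modification[OF meas cont]
  obtain Y' where "(\<forall>t. Y' t \<in> borel_measurable M) \<and> (\<forall>\<omega>. continuous_on UNIV (\<lambda>t. Y' t \<omega>)) \<and>
    (AE \<omega> in M. \<forall>t. Y' t \<omega> = Y t \<omega>)" ..
  then have Y' [measurable]: "\<And>t. Y' t \<in> borel_measurable M"
    and paths: "\<And>\<omega>. continuous_on UNIV (\<lambda>t. Y' t \<omega>)"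
    and eq: "AE \<omega> in M. \<forall>t. Y' t \<omega> = Y t \<omega>" by simp_all
  have [measurable]: "(\<lambda>p. Y' (snd p) (fst p)) \<in> borel_measurable (M \<Otimes>\<^sub>M borel)"
    by (rule borel_measurable_continuous_paths[OF Y' paths])
  have [measurable]: "(\<lambda>s. Y' s \<omega>) \<in> borel_measurable borel" for \<omega>
    by (rule borel_measurable_continuous_onI[OF paths])
  have moment: "(\<integral>\<^sup>+\<omega>. ennreal ((G (Y' s \<omega>))\<^sup>2) \<partial>M) = ennreal K" for s
  proof -
    have "distr M borel (Y' s) = std_normal_distribution"
      unfolding law[of s, symmetric] using meas by (intro distr_cong_AE AE_mp[OF eq AE_I2]) auto
    moreover have "(\<integral>\<^sup>+\<omega>. ennreal ((G (Y' s \<omega>))\<^sup>2) \<partial>M) = (\<integral>\<^sup>+x. ennreal ((G x)\<^sup>2) \<partial>distr M borel (Y' s))"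
      by (subst nn_integral_distr) auto
    moreover have "(\<integral>\<^sup>+x. ennreal ((G x)\<^sup>2) \<partial>std_normal_distribution) = ennreal K"
      unfolding K_def using G by (intro nn_integral_eq_integral) (auto simp: in_L2_gauss_def)
    ultimately show ?thesis by simp
  qed
  have meas2: "(\<lambda>p. ennreal ((G (Y' (snd p) (fst p)))\<^sup>2) * indicator {u..v} (snd p))
      \<in> borel_measurable (M \<Otimes>\<^sub>M lborel)" for u v
  proof -
    have "(\<lambda>p. ennreal ((G (Y' (snd p) (fst p)))\<^sup>2) * indicator {u..v} (snd p))
      \<in> borel_measurable (M \<Otimes>\<^sub>M borel)" by measurable
    then show ?thesis by (subst measurable_cong_sets[OF sets_pair_measure_cong refl]) auto
  qed
  have energy: "(\<integral>\<^sup>+\<omega>. (\<integral>\<^sup>+s. ennreal ((G (Y' s \<omega>))\<^sup>2) * indicator {u..v} s \<partial>lborel) \<partial>M) = ennreal (v - u) * ennreal K"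
    if "u \<le> v" for u v
  proof -
    have "(\<integral>\<^sup>+\<omega>. (\<integral>\<^sup>+s. ennreal ((G (Y' s \<omega>))\<^sup>2) * indicator {u..v} s \<partial>lborel) \<partial>M)
        = (\<integral>\<^sup>+s. (\<integral>\<^sup>+\<omega>. ennreal ((G (Y' s \<omega>))\<^sup>2) * indicator {u..v} s \<partial>M) \<partial>lborel)"
      using PL.Fubini'[of "\<lambda>\<omega> s. ennreal ((G (Y' s \<omega>))\<^sup>2) * indicator {u..v} s"] meas2[of u v]
      by (simp add: case_prod_beta')
    also have "\<dots> = (\<integral>\<^sup>+s. ennreal K * indicator {u..v} s \<partial>lborel)"
      by (simp add: nn_integral_multc moment)
    also have "\<dots> = ennreal (v - u) * ennreal K"
      using that by (simp add: nn_integral_cmult mult.commute)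
    finally show ?thesis .
  qed
  have "AE \<omega> in M. (\<integral>\<^sup>+s. ennreal ((G (Y' s \<omega>))\<^sup>2) * indicator {0..b} s \<partial>lborel) \<noteq> \<infinity>"
  proof (rule nn_integral_PInf_AE)
    show "(\<lambda>\<omega>. \<integral>\<^sup>+s. ennreal ((G (Y' s \<omega>))\<^sup>2) * indicator {0..b} s \<partial>lborel) \<in> borel_measurable M"
      using lborel.borel_measurable_nn_integral_fst[OF meas2[of 0 b]] by simp
    show "(\<integral>\<^sup>+\<omega>. (\<integral>\<^sup>+s. ennreal ((G (Y' s \<omega>))\<^sup>2) * indicator {0..b} s \<partial>lborel) \<partial>M) \<noteq> \<infinity>"
      using energy[of 0 b] ab by (simp add: ennreal_mult'[symmetric])
  qed
  moreover have "AE \<omega> in M. \<forall>t\<ge>0. X t \<omega> = X 0 \<omega> + \<alpha> * (LBINT s:{0..t}. G (Y s \<omega>))"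
    using sol by (simp add: slow_solution_def)
  ultimately have "AE \<omega> in M. ennreal ((X b \<omega> - X a \<omega>)\<^sup>2) \<le> ennreal (\<alpha>\<^sup>2 * (b - a)) *
      (\<integral>\<^sup>+s. ennreal ((G (Y' s \<omega>))\<^sup>2) * indicator {a..b} s \<partial>lborel)"
    using eq
  proof eventually_elim
    case (elim \<omega>)
    let ?D = "(LBINT s:{0..b}. G (Y' s \<omega>)) - (LBINT s:{0..a}. G (Y' s \<omega>))"
    have "X b \<omega> - X a \<omega> = \<alpha> * ?D"
      using elim(2)[rule_format, of a] elim(2)[rule_format, of b] elim(3) ab
      by (simp add: right_diff_distrib)
    then have "ennreal ((X b \<omega> - X a \<omega>)\<^sup>2) = ennreal (\<alpha>\<^sup>2) * ennreal (?D\<^sup>2)"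
      by (simp add: power_mult_distrib ennreal_mult')
    also have "\<dots> \<le> ennreal (\<alpha>\<^sup>2) * (ennreal (b - a) *
      (\<integral>\<^sup>+s. ennreal ((G (Y' s \<omega>))\<^sup>2) * indicator {a..b} s \<partial>lborel))"
      using elim(1) ab by (intro mult_left_mono squared_integral_increment_le) (auto simp: less_top)
    finally show ?case using ab by (simp add: ennreal_mult' mult.assoc)
  qed
  then have "(\<integral>\<^sup>+\<omega>. ennreal ((X b \<omega> - X a \<omega>)\<^sup>2) \<partial>M) \<le> (\<integral>\<^sup>+\<omega>. ennreal (\<alpha>\<^sup>2 * (b - a)) *
      (\<integral>\<^sup>+s. ennreal ((G (Y' s \<omega>))\<^sup>2) * indicator {a..b} s \<partial>lborel) \<partial>M)"
    by (rule nn_integral_mono_AE)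
  also have "\<dots> = ennreal (\<alpha>\<^sup>2 * (b - a)) * (ennreal (b - a) * ennreal K)"
    using lborel.borel_measurable_nn_integral_fst[OF meas2[of a b]] ab
    by (subst nn_integral_cmult) (auto simp: energy)
  also have "\<dots> = ennreal (\<alpha>\<^sup>2 * (b - a)\<^sup>2 * K)"
    using ab K by (simp add: ennreal_mult'[symmetric] power2_eq_square mult_ac)
  finally show ?thesis by (simp add: K_def)
qed

section \<open>The estimator\<close>

definition estimator_prefactor :: "real \<Rightarrow> nat \<Rightarrow> real" where
  "estimator_prefactor h N = (if h > 1 / 2 then real N powr (2 * h - 1) else 1)"

lemma estimator_bound:
  fixes X :: "real \<Rightarrow> 'a \<Rightarrow> real"
  assumes meas: "\<And>t. t \<ge> 0 \<Longrightarrow> X t \<in> borel_measurable M" and d: "d \<ge> 0" and C: "C \<ge> 0"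
    and incr: "\<And>a b. 0 \<le> a \<Longrightarrow> a \<le> b \<Longrightarrow> (\<integral>\<^sup>+\<omega>. ennreal ((X b \<omega> - X a \<omega>)\<^sup>2) \<partial>M) \<le> ennreal (C * (b - a)\<^sup>2)"
  shows "(\<integral>\<^sup>+\<omega>. ennreal (estimator h N d X \<omega>) \<partial>M) \<le> ennreal (estimator_prefactor h N * (real N * (C * d\<^sup>2)))"
proof -
  have p: "estimator_prefactor h N \<ge> 0" by (simp add: estimator_prefactor_def)
  have [measurable]: "X (real i * d) \<in> borel_measurable M" for i
    using d by (intro meas) simp
  have "(\<integral>\<^sup>+\<omega>. ennreal (estimator h N d X \<omega>) \<partial>M) = (\<integral>\<^sup>+\<omega>. ennreal (estimator_prefactor h N) *
      (\<Sum>i<N. ennreal ((X (real (i + 1) * d) \<omega> - X (real i * d) \<omega>)\<^sup>2)) \<partial>M)"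
  proof (rule nn_integral_cong)
    fix \<omega>
    have "estimator h N d X \<omega> = estimator_prefactor h N *
        (\<Sum>i<N. (X (real (i + 1) * d) \<omega> - X (real i * d) \<omega>)\<^sup>2)"
      by (simp add: estimator_def estimator_prefactor_def)
    then show "ennreal (estimator h N d X \<omega>) = ennreal (estimator_prefactor h N) *
        (\<Sum>i<N. ennreal ((X (real (i + 1) * d) \<omega> - X (real i * d) \<omega>)\<^sup>2))"
      using p by (simp add: ennreal_mult' sum_ennreal)
  qed
  also have "\<dots> = ennreal (estimator_prefactor h N) *
      (\<Sum>i<N. \<integral>\<^sup>+\<omega>. ennreal ((X (real (i + 1) * d) \<omega> - X (real i * d) \<omega>)\<^sup>2) \<partial>M)"
    by (subst nn_integral_cmult) (auto simp: nn_integral_sum simp del: sum_ennreal of_nat_add of_nat_Suc)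
  also have "\<dots> \<le> ennreal (estimator_prefactor h N) * (\<Sum>i<N. ennreal (C * d\<^sup>2))"
  proof (intro mult_left_mono sum_mono)
    fix i
    have "(\<integral>\<^sup>+\<omega>. ennreal ((X (real (i + 1) * d) \<omega> - X (real i * d) \<omega>)\<^sup>2) \<partial>M)
        \<le> ennreal (C * (real (i + 1) * d - real i * d)\<^sup>2)"
      using d by (intro incr mult_right_mono) auto
    also have "real (i + 1) * d - real i * d = d" by (simp add: algebra_simps)
    finally show "(\<integral>\<^sup>+\<omega>. ennreal ((X (real (i + 1) * d) \<omega> - X (real i * d) \<omega>)\<^sup>2) \<partial>M) \<le> ennreal (C * d\<^sup>2)" .
  qed simp
  also have "\<dots> = ennreal (estimator_prefactor h N * (real N * (C * d\<^sup>2)))"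
    using p C by (simp add: ennreal_mult' ennreal_of_nat_eq_real_of_nat)
  finally show ?thesis .
qed

text \<open>With \<open>N = T / d\<close> every regime becomes a function of the ratio \<open>d / \<epsilon>\<close> alone. In the critical
  case the logarithm only helps, because \<open>\<bar>ln \<epsilon>\<bar> \<ge> 1\<close> for \<open>\<epsilon> \<le> 1 / e\<close>.\<close>

lemma estimator_rate:
  fixes d N \<epsilon> T h :: real
  assumes "0 < \<epsilon>" "\<epsilon> < exp (- 1)" "0 < d" "N * d = T" "T > 0"
  shows "(if h > 1 / 2 then N powr (2 * h - 1) else 1) * (N * ((slow_scaling \<epsilon> h)\<^sup>2 * d\<^sup>2))
    \<le> (if h > 1 / 2 then T powr (2 * h) * (d / \<epsilon>) powr (2 - 2 * h) else T * (d / \<epsilon>))"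
proof (cases "h > 1 / 2")
  case True
  have N: "N = T / d" "N > 0" using assms by (auto simp: field_simps zero_less_mult_iff)
  have "N powr (2 * h - 1) * (N * ((\<epsilon> powr (h - 1))\<^sup>2 * d\<^sup>2))
     = (N powr (2 * h - 1) * N powr 1) * (\<epsilon> powr (2 * h - 2) * d powr 2)"
    using N assms by (simp add: powr_power algebra_simps)
  also have "\<dots> = N powr (2 * h) * (\<epsilon> powr (2 * h - 2) * d powr 2)"
    by (simp only: powr_add[symmetric]) simp
  also have "\<dots> = T powr (2 * h) * (d powr (2 - 2 * h) / \<epsilon> powr (2 - 2 * h))"
    using assms by (simp add: N powr_divide powr_diff powr_minus field_simps)
  also have "\<dots> = T powr (2 * h) * (d / \<epsilon>) powr (2 - 2 * h)"
    using assms by (simp add: powr_divide)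
  finally show ?thesis using True by (simp add: slow_scaling_def)
next
  case False
  have "(slow_scaling \<epsilon> h)\<^sup>2 \<le> 1 / \<epsilon>"
  proof (cases "h = 1 / 2")
    case True
    have "ln \<epsilon> < ln (exp (- 1))" using assms by (subst ln_less_cancel_iff) auto
    then have "\<bar>ln \<epsilon>\<bar> \<ge> 1" by simp
    moreover from this have "\<bar>ln \<epsilon>\<bar> > 0" by linarith
    ultimately have "1 / (\<epsilon> * \<bar>ln \<epsilon>\<bar>) \<le> 1 / \<epsilon>"
      using assms by (intro divide_left_mono mult_pos_pos) auto
    then show ?thesis using True assms by (simp add: slow_scaling_def power_divide)
  next
    case ne: False
    then show ?thesis using False assms by (simp add: slow_scaling_def power_divide)
  qed
  then have "T * d * (slow_scaling \<epsilon> h)\<^sup>2 \<le> T * d * (1 / \<epsilon>)"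
    using assms by (intro mult_left_mono) auto
  moreover have "N * ((slow_scaling \<epsilon> h)\<^sup>2 * d\<^sup>2) = T * d * (slow_scaling \<epsilon> h)\<^sup>2"
    by (simp add: assms(4)[symmetric] power2_eq_square)
  ultimately have "N * ((slow_scaling \<epsilon> h)\<^sup>2 * d\<^sup>2) \<le> T * (d / \<epsilon>)"
    by (simp only: times_divide_eq_right mult_1_right)
  then show ?thesis using False by simp
qed

theorem proposition3p1:
  fixes M :: "'a measure"
    and H T :: real
    and m :: nat
    and G :: "real \<Rightarrow> real"
    and B :: "real \<Rightarrow> 'a \<Rightarrow> real"
    and X Y :: "real \<Rightarrow> real \<Rightarrow> 'a \<Rightarrow> real"
    and \<delta> :: "real \<Rightarrow> real"
    and N :: "real \<Rightarrow> nat"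
  assumes "prob_space M"
    and "0 < H" and "H < 1"
    and "in_L2_gauss G"
    and "m \<ge> 1" and "has_hermite_rank G m"
    and "fractional_brownian_motion M H B"
    and "\<And>\<epsilon>. \<epsilon> > 0 \<Longrightarrow> stationary_fou_solution M H B \<epsilon> (Y \<epsilon>)"
    and "\<And>\<epsilon>. \<epsilon> > 0 \<Longrightarrow> slow_solution M (slow_scaling \<epsilon> (Hstar H m)) G (Y \<epsilon>) (X \<epsilon>)"
    and "T > 0"
    and "\<And>\<epsilon>. \<epsilon> > 0 \<Longrightarrow> \<delta> \<epsilon> > 0 \<and> real (N \<epsilon>) * \<delta> \<epsilon> = T"
    and "(\<delta> \<longlongrightarrow> 0) (at_right 0)"
    and "((\<lambda>\<epsilon>. \<delta> \<epsilon> / \<epsilon>) \<longlongrightarrow> 0) (at_right 0)"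
  shows "((\<lambda>\<epsilon>. \<integral>\<^sup>+ \<omega>. ennreal (estimator (Hstar H m) (N \<epsilon>) (\<delta> \<epsilon>) (X \<epsilon>) \<omega>) \<partial>M)
           \<longlongrightarrow> 0) (at_right 0)"
proof -
  define h where "h = Hstar H m"
  define K where "K = (LINT x|std_normal_distribution. (G x)\<^sup>2)"
  have K: "K \<ge> 0" by (simp add: K_def)
  have h: "h < 1" using assms(3,5) by (simp add: h_def Hstar_def mult_neg_pos)
  define r where "r x = (if h > 1 / 2 then T powr (2 * h) * x powr (2 - 2 * h) else T * x)" for x
  have bound: "(\<integral>\<^sup>+ \<omega>. ennreal (estimator h (N \<epsilon>) (\<delta> \<epsilon>) (X \<epsilon>) \<omega>) \<partial>M) \<le> ennreal (K * r (\<delta> \<epsilon> / \<epsilon>))"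
    if \<epsilon>: "0 < \<epsilon>" "\<epsilon> < exp (- 1)" for \<epsilon>
  proof -
    let ?\<alpha> = "slow_scaling \<epsilon> h"
    note fou = assms(8)[OF \<epsilon>(1)]
    have law: "distr M borel (Y \<epsilon> t) = std_normal_distribution" for t
      by (rule stationary_fou_marginal[OF assms(1,2,7) \<epsilon>(1) fou])
    have meas: "Y \<epsilon> t \<in> borel_measurable M" for t
      using fou by (simp add: stationary_fou_solution_def strictly_stationary_def)
    have cont: "AE \<omega> in M. continuous_on UNIV (\<lambda>t. Y \<epsilon> t \<omega>)"
      using fou by (auto simp: stationary_fou_solution_def)
    have slow: "slow_solution M ?\<alpha> G (Y \<epsilon>) (X \<epsilon>)" using assms(9)[OF \<epsilon>(1)] by (simp add: h_def)
    have \<delta>: "\<delta> \<epsilon> > 0" "real (N \<epsilon>) * \<delta> \<epsilon> = T" using assms(11)[OF \<epsilon>(1)] by auto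
    have "(\<integral>\<^sup>+ \<omega>. ennreal (estimator h (N \<epsilon>) (\<delta> \<epsilon>) (X \<epsilon>) \<omega>) \<partial>M)
      \<le> ennreal (estimator_prefactor h (N \<epsilon>) * (real (N \<epsilon>) * ((?\<alpha>\<^sup>2 * K) * (\<delta> \<epsilon>)\<^sup>2)))"
    proof (rule estimator_bound)
      show "X \<epsilon> t \<in> borel_measurable M" if "t \<ge> 0" for t
        using slow that by (simp add: slow_solution_def)
      show "(\<integral>\<^sup>+\<omega>. ennreal ((X \<epsilon> b \<omega> - X \<epsilon> a \<omega>)\<^sup>2) \<partial>M) \<le> ennreal (?\<alpha>\<^sup>2 * K * (b - a)\<^sup>2)"
        if "0 \<le> a" "a \<le> b" for a b
        using slow_increment_second_moment[OF assms(1) law meas cont assms(4) slow that]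
        by (simp add: K_def mult_ac)
    qed (use \<delta> K in auto)
    also have "\<dots> \<le> ennreal (K * r (\<delta> \<epsilon> / \<epsilon>))"
    proof (rule ennreal_leI)
      have "estimator_prefactor h (N \<epsilon>) * (real (N \<epsilon>) * (?\<alpha>\<^sup>2 * (\<delta> \<epsilon>)\<^sup>2)) \<le> r (\<delta> \<epsilon> / \<epsilon>)"
        using estimator_rate[OF \<epsilon> \<delta> assms(10), of h] by (simp add: estimator_prefactor_def r_def)
      from mult_left_mono[OF this K]
      show "estimator_prefactor h (N \<epsilon>) * (real (N \<epsilon>) * (?\<alpha>\<^sup>2 * K * (\<delta> \<epsilon>)\<^sup>2)) \<le> K * r (\<delta> \<epsilon> / \<epsilon>)"
        by (simp add: mult_ac)
    qed
    finally show ?thesis .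
  qed
  have "((\<lambda>\<epsilon>. K * r (\<delta> \<epsilon> / \<epsilon>)) \<longlongrightarrow> 0) (at_right 0)"
  proof (cases "h > 1 / 2")
    case True
    have "((\<lambda>\<epsilon>. (\<delta> \<epsilon> / \<epsilon>) powr (2 - 2 * h)) \<longlongrightarrow> 0) (at_right 0)"
    proof (rule tendsto_zero_powrI[OF assms(13) tendsto_const])
      show "\<forall>\<^sub>F \<epsilon> in at_right 0. 0 \<le> \<delta> \<epsilon> / \<epsilon>"
        using eventually_at_right_less[of "0 :: real"]
        by eventually_elim (use assms(11) in \<open>simp add: less_imp_le\<close>)
    qed (use h in simp)
    from tendsto_mult_right_zero[OF this, of "K * T powr (2 * h)"] True show ?thesis
      by (simp add: r_def mult_ac)
  next
    case False
    from tendsto_mult_right_zero[OF assms(13), of "K * T"] False show ?thesis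
      by (simp add: r_def mult_ac)
  qed
  then have lim: "((\<lambda>\<epsilon>. ennreal (K * r (\<delta> \<epsilon> / \<epsilon>))) \<longlongrightarrow> 0) (at_right 0)"
    using tendsto_ennrealI by fastforce
  have "\<forall>\<^sub>F \<epsilon> in at_right 0. (\<integral>\<^sup>+ \<omega>. ennreal (estimator h (N \<epsilon>) (\<delta> \<epsilon>) (X \<epsilon>) \<omega>) \<partial>M) \<le> ennreal (K * r (\<delta> \<epsilon> / \<epsilon>))"
    by (rule eventually_mono[OF eventually_at_right_real[of 0 "exp (- 1)"]]) (auto intro!: bound)
  from tendsto_sandwich[OF _ this tendsto_const lim] show ?thesis by (simp add: h_def)
qed

end
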